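(* Let $n,k\ge1$, $\alpha>0$, let $\mathcal{A}$ be an $\alpha$-stretch correlated sampling algorithm for $\Delta_{n,k}$, and let $\mathrm{ALG}$ be the composed algorithm described in the context. Suppose $\mathcal{A}$ and $\mathcal{A}_k$ satisfy submodular dominance. Then the output of $\mathrm{ALG}$ satisfies submodular dominance: for every $\mathbf{x}\in\Delta_{n,k}$ and every submodular $f:2^{[n]}\to\mathbb{R}$, $\mathbb{E}[f(\mathrm{ALG}(\mathbf{x}))]\ge F(\mathbb{E}[\mathbf{1}_{\mathrm{ALG}(\mathbf{x})}])$, where $F$ is the multilinear extension of $f$.
   Context: $f:2^E\to\mathbb{R}$ is submodular if $f(S\cup\{e\})-f(S)\ge f(T\cup\{e\})-f(T)$ for all $S\subseteq T\subseteq E\setminus\{e\}$. Its multilinear extension is $F(\mathbf{x})=\sum_{S\subseteq E}f(S)\prod_{i\in S}x_i\prod_{i\notin S}(1-x_i)$. A randomized rounding procedure satisfies submodular dominance if for each input its random output $\mathbf{X}\in\{0,1\}^E$ satisfies $\mathbb{E}[f(\mathbf{X})]\ge F(\mathbb{E}[\mathbf{X}])$ for every submodular $f$. $\Delta_{n,k}=\{\mathbf{x}\in[0,1]^n:\|\mathbf{x}\|_1\le k\}$. A correlated sampling algorithm for $\Delta_{n,k}$ is a distribution over deterministic maps $\Delta_{n,k}\to2^{[n]}$, drawn once and applied to all inputs; it is $\alpha$-stretch if for all $\mathbf{x},\mathbf{y}$: (P1) output size is $\lfloor\|\mathbf{x}\|_1\rfloor$ or $\lceil\|\mathbf{x}\|_1\rceil$;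 (P2) $\Pr[i\in\text{output}(\mathbf{x})]=x_i$; (P3) $\mathbb{E}|\text{output}(\mathbf{x})\oplus\text{output}(\mathbf{y})|\le\alpha\|\mathbf{x}-\mathbf{y}\|_1$. Logs base 2. Composed algorithm. Put $m=2^5k^5\alpha^5$, $d=m^3$. Subroutine $\mathcal{A}_1$: draw i.i.d. $E_1,\dots,E_n\sim\mathrm{Exp}(1)$; on a probability vector $\mathbf{p}$ output $\{\arg\min_{i:p_i>0}E_i/p_i\}$. Subroutine $\mathcal{A}_k$ (tree pivotal sampling on $[d]$): fix a binary tree of depth $\lceil\log d\rceil$ with leaves $1,\dots,d$; independent $\theta_z\sim\mathrm{Uni}[0,1]$ per internal node plus an extra $\theta_{root}$. On $\mathbf{z}\in\Delta_{d,k}$, leaves pass $(i,z_i)$ up; an internal node receiving $(i,a),(j,b)$: if $a+b\le1$, with $\theta_z\le a/(a+b)$ set $(a+b,0)$ for $(i,j)$ and fix $j$, else $(0,a+b)$ and fix $i$; if $a+b>1$, with $\theta_z\le(1-b)/(2-a-b)$ set $(1,a+b-1)$ and fix $i$, else $(a+b-1,1)$ and fix $j$; pass the non-fixed coordinate up. At the root the remaining coordinate with value $\gamma$ gets 1 iff $\theta_{root}<\gamma$. Output: coordinates with final value 1. Shared randomness (drawn once, independently): randomness of $\mathcal{A},\mathcal{A}_1,\mathcal{A}_k$; $R_b\sim\mathrm{Uni}([d])$, $b\in[m]$; $C_i\sim\mathrm{Uni}([d])$ and uniform bucket $\beta(i)\in[m]$, $i\in[n]$, $\mathcal{B}_b=\{i:\beta(i)=b\}$;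 $\sigma,\tau\sim\mathrm{Uni}[0,1/10]$. $\mathrm{ALG}(\mathbf{x})$: $S=\{i:0<x_i\le1/10+\sigma\}$, $L=\{i:x_i>1/10+\sigma\}$. (a) If two distinct members of the family $(C_i)_{i\in L},(R_b)_{b\in[m]}$ coincide, return $\mathcal{A}(\mathbf{x})$. (b) Else if some $b$ has $\sum_{i\in S\cap\mathcal{B}_b}x_i>1-\tau$, return $\mathcal{A}(\mathbf{x})$. (c) Else for each $b$ with $s_b=\sum_{i\in S\cap\mathcal{B}_b}x_i>0$ let $REP_b=\mathcal{A}_1(\mathbf{p}^b)$, $p^b_i=x_i/s_b$ on $S\cap\mathcal{B}_b$; define $\hat{\mathbf{x}}\in[0,1]^d$ with $\hat x_{R_b}=s_b$, $\hat x_{C_i}=x_i$ ($i\in L$), zero elsewhere; $T=\mathcal{A}_k(\hat{\mathbf{x}})$; return $\{i\in L:C_i\in T\}\cup\bigcup_{b:s_b>0,R_b\in T}REP_b$. *)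

theory Defs
  imports "HOL-Probability.Probability"
begin

section \<open>Submodular functions and submodular dominance\<close>

definition submodular_on :: "'e set \<Rightarrow> ('e set \<Rightarrow> real) \<Rightarrow> bool" where
  "submodular_on E f \<longleftrightarrow>
     (\<forall>S T e. e \<in> E \<and> S \<subseteq> T \<and> T \<subseteq> E - {e} \<longrightarrow>
        f (S \<union> {e}) - f S \<ge> f (T \<union> {e}) - f T)"

definition multilinear_extension :: "'e set \<Rightarrow> ('e set \<Rightarrow> real) \<Rightarrow> ('e \<Rightarrow> real) \<Rightarrow> real" where
  "multilinear_extension E f x =
     (\<Sum>S\<in>Pow E. f S * (\<Prod>i\<in>S. x i) * (\<Prod>i\<in>E - S. 1 - x i))"

text \<open>
  A randomized procedure with inputs \<open>D\<close> and output in \<open>2\<^sup>E\<close> is a map \<open>X\<close> taking an outcome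
  of a probability space \<open>M\<close> and an input: one draw from \<open>M\<close> is a deterministic map
  \<open>D \<rightarrow> 2\<^sup>E\<close>, so the same draw can be applied to all inputs. Measurability is required explicitly
  because the Bochner integral of a non-integrable function is 0.
\<close>
definition randomized_procedure ::
    "'w measure \<Rightarrow> 'e set \<Rightarrow> 'x set \<Rightarrow> ('w \<Rightarrow> 'x \<Rightarrow> 'e set) \<Rightarrow> bool" where
  "randomized_procedure M E D X \<longleftrightarrow>
     prob_space M \<and> (\<forall>x\<in>D. (\<lambda>\<omega>. X \<omega> x) \<in> measurable M (count_space (Pow E)))"

definition submodular_dominance ::
    "'w measure \<Rightarrow> 'e set \<Rightarrow> 'x set \<Rightarrow> ('w \<Rightarrow> 'x \<Rightarrow> 'e set) \<Rightarrow> bool" where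
  "submodular_dominance M E D X \<longleftrightarrow>
     randomized_procedure M E D X \<and>
     (\<forall>x\<in>D. \<forall>f. submodular_on E f \<longrightarrow>
        (LINT \<omega>|M. f (X \<omega> x)) \<ge>
          multilinear_extension E f (\<lambda>i. LINT \<omega>|M. indicator (X \<omega> x) i))"


section \<open>Correlated sampling\<close>

definition l1_norm :: "nat \<Rightarrow> (nat \<Rightarrow> real) \<Rightarrow> real" where
  "l1_norm n x = (\<Sum>i\<in>{1..n}. \<bar>x i\<bar>)"

text \<open>Points of \<open>[0,1]\<^sup>n\<close> are functions on \<open>{1..n}\<close>, \<^const>\<open>undefined\<close> elsewhere.\<close>
definition Delta :: "nat \<Rightarrow> nat \<Rightarrow> (nat \<Rightarrow> real) set" where
  "Delta n k = {x \<in> {1..n} \<rightarrow>\<^sub>E {0..1}. l1_norm n x \<le> real k}"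

definition correlated_sampling ::
    "nat \<Rightarrow> nat \<Rightarrow> 'w measure \<Rightarrow> ('w \<Rightarrow> (nat \<Rightarrow> real) \<Rightarrow> nat set) \<Rightarrow> bool" where
  "correlated_sampling n k M A \<longleftrightarrow> randomized_procedure M {1..n} (Delta n k) A"

definition stretch_correlated_sampling ::
    "real \<Rightarrow> nat \<Rightarrow> nat \<Rightarrow> 'w measure \<Rightarrow> ('w \<Rightarrow> (nat \<Rightarrow> real) \<Rightarrow> nat set) \<Rightarrow> bool" where
  "stretch_correlated_sampling \<alpha> n k M A \<longleftrightarrow>
     correlated_sampling n k M A \<and>
     (\<forall>x\<in>Delta n k. AE \<omega> in M.
        int (card (A \<omega> x)) = \<lfloor>l1_norm n x\<rfloor> \<or> int (card (A \<omega> x)) = \<lceil>l1_norm n x\<rceil>) \<and>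
     (\<forall>x\<in>Delta n k. \<forall>i\<in>{1..n}. measure M {\<omega> \<in> space M. i \<in> A \<omega> x} = x i) \<and>
     (\<forall>x\<in>Delta n k. \<forall>y\<in>Delta n k.
        (LINT \<omega>|M. real (card (sym_diff (A \<omega> x) (A \<omega> y)))) \<le> \<alpha> * l1_norm n (\<lambda>i. x i - y i))"


section \<open>The subroutine for probability vectors\<close>

definition exp_clocks :: "nat \<Rightarrow> (nat \<Rightarrow> real) measure" where
  "exp_clocks n = PiM {1..n} (\<lambda>_. density lborel (\<lambda>t. ennreal (exponential_density 1 t)))"

text \<open>Ties have probability 0; \<^const>\<open>arg_min_on\<close> then chooses one of the minimizers.\<close>
definition A1 :: "nat \<Rightarrow> (nat \<Rightarrow> real) \<Rightarrow> (nat \<Rightarrow> real) \<Rightarrow> nat set" where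
  "A1 n E p = {arg_min_on (\<lambda>i. E i / p i) {i \<in> {1..n}. p i > 0}}"


section \<open>Tree pivotal sampling\<close>

datatype pivot_tree = Lf nat | Br pivot_tree pivot_tree

fun tree_leaves :: "pivot_tree \<Rightarrow> nat list" where
  "tree_leaves (Lf i) = [i]"
| "tree_leaves (Br l r) = tree_leaves l @ tree_leaves r"

fun tree_depth :: "pivot_tree \<Rightarrow> nat" where
  "tree_depth (Lf i) = 0"
| "tree_depth (Br l r) = Suc (max (tree_depth l) (tree_depth r))"

text \<open>An internal node is addressed by its path from the root (\<open>False\<close> = left, \<open>True\<close> = right).\<close>
fun inner_nodes :: "pivot_tree \<Rightarrow> bool list set" where
  "inner_nodes (Lf i) = {}"
| "inner_nodes (Br l r) =
     insert [] (Cons False ` inner_nodes l \<union> Cons True ` inner_nodes r)"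

definition pivot_tree_for :: "nat \<Rightarrow> pivot_tree \<Rightarrow> bool" where
  "pivot_tree_for d t \<longleftrightarrow>
     distinct (tree_leaves t) \<and> set (tree_leaves t) = {1..d} \<and>
     int (tree_depth t) = \<lceil>log 2 (real d)\<rceil>"

definition pivot_space :: "pivot_tree \<Rightarrow> ((bool list \<Rightarrow> real) \<times> real) measure" where
  "pivot_space t =
     PiM (inner_nodes t) (\<lambda>_. uniform_measure lborel {0..1}) \<Otimes>\<^sub>M uniform_measure lborel {0..1}"

text \<open>
  Processes a subtree and returns the non-fixed coordinate that is passed up, together with the
  updated vector, whose entry at that coordinate is the value passed up.
  When \<open>a = b = 0\<close> or \<open>a = b = 1\<close> the quotient is \<open>0 / 0\<close>, but both branches then give the
  same vector.
\<close>
fun pivot :: "(bool list \<Rightarrow> real) \<Rightarrow> pivot_tree \<Rightarrow> (nat \<Rightarrow> real) \<Rightarrow> nat \<times> (nat \<Rightarrow> real)" where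
  "pivot \<theta> (Lf i) v = (i, v)"
| "pivot \<theta> (Br l r) v =
     (let (i, v1) = pivot (\<lambda>q. \<theta> (False # q)) l v;
          (j, v2) = pivot (\<lambda>q. \<theta> (True # q)) r v1;
          a = v2 i; b = v2 j
      in if a + b \<le> 1
         then (if \<theta> [] \<le> a / (a + b)
               then (i, v2(i := a + b, j := 0))
               else (j, v2(i := 0, j := a + b)))
         else (if \<theta> [] \<le> (1 - b) / (2 - a - b)
               then (j, v2(i := 1, j := a + b - 1))
               else (i, v2(i := a + b - 1, j := 1))))"

definition tree_pivotal ::
    "pivot_tree \<Rightarrow> (bool list \<Rightarrow> real) \<times> real \<Rightarrow> (nat \<Rightarrow> real) \<Rightarrow> nat set" where
  "tree_pivotal t = (\<lambda>(\<theta>, \<theta>root) z.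
     let (i, v) = pivot \<theta> t z;
         w = v(i := (if \<theta>root < v i then 1 else 0))
     in {j \<in> set (tree_leaves t). w j = 1})"


section \<open>The composed algorithm\<close>

text \<open>
  The intended number of buckets is \<open>2\<^sup>5 k\<^sup>5 \<alpha>\<^sup>5\<close>; it is rounded up since \<open>\<alpha>\<close> need
  not make it an integer.
\<close>
definition num_buckets :: "nat \<Rightarrow> real \<Rightarrow> nat" where
  "num_buckets k \<alpha> = nat \<lceil>2 ^ 5 * real k ^ 5 * \<alpha> ^ 5\<rceil>"

definition hash_dim :: "nat \<Rightarrow> real \<Rightarrow> nat" where
  "hash_dim k \<alpha> = num_buckets k \<alpha> ^ 3"

type_synonym 'w alg_randomness =
  "'w \<times> (nat \<Rightarrow> real) \<times> ((bool list \<Rightarrow> real) \<times> real) \<times>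
   (nat \<Rightarrow> nat) \<times> (nat \<Rightarrow> nat) \<times> (nat \<Rightarrow> nat) \<times> real \<times> real"

text \<open>
  The components are, in order: the randomness of the three subroutines, the \<open>R\<^sub>b\<close>, the
  \<open>C\<^sub>i\<close>, the buckets \<open>\<beta>(i)\<close>, \<open>\<sigma>\<close> and \<open>\<tau>\<close>.
\<close>
definition alg_space ::
    "nat \<Rightarrow> nat \<Rightarrow> real \<Rightarrow> 'w measure \<Rightarrow> pivot_tree \<Rightarrow> 'w alg_randomness measure" where
  "alg_space n k \<alpha> M t =
     (let m = num_buckets k \<alpha>; d = hash_dim k \<alpha> in
      M \<Otimes>\<^sub>M exp_clocks n \<Otimes>\<^sub>M pivot_space t \<Otimes>\<^sub>M
      PiM {1..m} (\<lambda>_. uniform_count_measure {1..d}) \<Otimes>\<^sub>M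
      PiM {1..n} (\<lambda>_. uniform_count_measure {1..d}) \<Otimes>\<^sub>M
      PiM {1..n} (\<lambda>_. uniform_count_measure {1..m}) \<Otimes>\<^sub>M
      uniform_measure lborel {0..1/10} \<Otimes>\<^sub>M uniform_measure lborel {0..1/10})"

text \<open>
  The family \<open>(C\<^sub>i)\<^sub>i\<^sub>\<in>\<^sub>L, (R\<^sub>b)\<^sub>b\<close> is indexed by the disjoint sum \<open>L <+> {1..m}\<close>.
  In the last case it is injective, so \<^const>\<open>inv_into\<close> recovers the unique index mapped to \<open>j\<close>,
  and for \<open>s b = 0\<close> the entry at \<open>R b\<close> is 0.
\<close>
definition ALG ::
    "nat \<Rightarrow> nat \<Rightarrow> real \<Rightarrow> ('w \<Rightarrow> (nat \<Rightarrow> real) \<Rightarrow> nat set) \<Rightarrow> pivot_tree \<Rightarrow>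
     'w alg_randomness \<Rightarrow> (nat \<Rightarrow> real) \<Rightarrow> nat set" where
  "ALG n k \<alpha> A t = (\<lambda>(\<omega>, E, \<theta>, R, C, \<beta>, \<sigma>, \<tau>) x.
     let m = num_buckets k \<alpha>;
         d = hash_dim k \<alpha>;
         S = {i \<in> {1..n}. 0 < x i \<and> x i \<le> 1/10 + \<sigma>};
         L = {i \<in> {1..n}. x i > 1/10 + \<sigma>};
         B = (\<lambda>b. {i \<in> {1..n}. \<beta> i = b});
         s = (\<lambda>b. \<Sum>i\<in>S \<inter> B b. x i)
     in if \<not> inj_on (case_sum C R) (L <+> {1..m}) then A \<omega> x
        else if \<exists>b\<in>{1..m}. s b > 1 - \<tau> then A \<omega> x
        else
          let p = (\<lambda>b i. if i \<in> S \<inter> B b then x i / s b else 0);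
              REP = (\<lambda>b. A1 n E (p b));
              xhat = (\<lambda>j\<in>{1..d}.
                 if j \<in> R ` {1..m} then s (inv_into {1..m} R j)
                 else if j \<in> C ` L then x (inv_into L C j)
                 else 0);
              T = tree_pivotal t \<theta> xhat
          in {i \<in> L. C i \<in> T} \<union> (\<Union>b\<in>{b \<in> {1..m}. s b > 0 \<and> R b \<in> T}. REP b))"

end

theory Submission
  imports Defs
begin

text \<open>
  Fix the hash values and thresholds. In the fallback branch the claim is the dominance of \<open>A\<close>,
  whose marginals are the input. In the main branch, the coordinates \<open>e\<close> of the hashed vector
  partition the positive elements into fibres of weight at most 1, and the output picks from every
  fibre selected by pivotal sampling the winner of an exponential race. For fixed winners the value
  is a submodular function of the selected fibres, and tree pivotal sampling preserves marginals,
  so its dominance reduces the claim to independent selection of the fibres. Races in disjoint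
  fibres are independent, and choosing one winner in a fibre of total weight at most 1 dominates
  independent rounding there; processing the fibres one at a time gives \<open>F(x)\<close>. Thus
  every conditional expectation is at least \<open>F(x)\<close>. Applied to the modular functions
  \<open>\<plusminus> 1[i \<in> S]\<close>, the same bound shows that the marginals of the output are \<open>x\<close>.
\<close>

section \<open>Multilinear extensions of submodular functions\<close>

text \<open>Two features of the hypothesis on \<open>tree_pivotal t\<close> shape the proof. It
  compares with the marginals of the sampled set without naming them, so these have to be computed:
  every pivot step is a martingale step. And it concerns functions of the selected coordinates
  alone, while the returned set also depends on the exponential clocks. So the clocks are frozen
  first, which gives every fibre a definite winner; only after the coordinates have been replaced by
  independent ones are the clocks averaged. One winner per fibre beats independent rounding by
  diminishing returns: a further element gains at most what it gains on the empty set. Selecting a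
  fibre of weight \<open>s\<close> and then \<open>i\<close> with probability \<open>x i / s\<close>
  gives \<open>i\<close> probability \<open>x i\<close> and leaves \<open>1 - s\<close> for the
  empty choice, whence the need for \<open>s \<le> 1\<close>. For buckets this is the threshold
  \<open>1 - \<tau>\<close> with \<open>\<tau> \<ge> 0\<close>; for large elements it is
  \<open>x i \<le> 1\<close>.\<close>

lemma multilinear_extension_empty [simp]: "multilinear_extension {} f x = f {}"
  by (simp add: multilinear_extension_def)

text \<open>Conditioning on whether \<open>i\<close> is chosen; this recursion drives the inductions
  on the ground set below.\<close>

lemma multilinear_extension_insert:
  assumes "finite E" "i \<notin> E"
  shows "multilinear_extension (insert i E) f x =
    x i * multilinear_extension E (\<lambda>S. f (insert i S)) x + (1 - x i) * multilinear_extension E f x"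
proof -
  have inj: "inj_on (insert i) (Pow E)"
    using assms by (auto simp: inj_on_def)
  have fin: "finite S" if "S \<subseteq> E" for S
    using that assms finite_subset by blast
  have 1: "(\<Sum>S\<in>insert i ` Pow E. f S * (\<Prod>i\<in>S. x i) * (\<Prod>i\<in>insert i E - S. 1 - x i)) =
      x i * multilinear_extension E (\<lambda>S. f (insert i S)) x"
  proof -
    have "f (insert i S) * (\<Prod>i\<in>insert i S. x i) * (\<Prod>i\<in>insert i E - insert i S. 1 - x i) =
        x i * (f (insert i S) * (\<Prod>i\<in>S. x i) * (\<Prod>i\<in>E - S. 1 - x i))" if "S \<subseteq> E" for S
    proof -
      have "insert i E - insert i S = E - S" "i \<notin> S" using assms that by auto
      then show ?thesis using fin[OF that] by simp
    qed
    then show ?thesis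
      unfolding multilinear_extension_def
      by (subst sum.reindex[OF inj]) (auto simp: sum_distrib_left intro!: sum.cong)
  qed
  have 2: "(\<Sum>S\<in>Pow E. f S * (\<Prod>i\<in>S. x i) * (\<Prod>i\<in>insert i E - S. 1 - x i)) =
      (1 - x i) * multilinear_extension E f x"
  proof -
    have "f S * (\<Prod>i\<in>S. x i) * (\<Prod>i\<in>insert i E - S. 1 - x i) =
        (1 - x i) * (f S * (\<Prod>i\<in>S. x i) * (\<Prod>i\<in>E - S. 1 - x i))" if "S \<subseteq> E" for S
    proof -
      have "insert i E - S = insert i (E - S)" using assms that by auto
      then show ?thesis using assms by simp
    qed
    then show ?thesis
      unfolding multilinear_extension_def by (auto simp: sum_distrib_left intro!: sum.cong)
  qed
  have "multilinear_extension (insert i E) f x =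
      (\<Sum>S\<in>insert i ` Pow E. f S * (\<Prod>i\<in>S. x i) * (\<Prod>i\<in>insert i E - S. 1 - x i)) +
      (\<Sum>S\<in>Pow E. f S * (\<Prod>i\<in>S. x i) * (\<Prod>i\<in>insert i E - S. 1 - x i))"
    unfolding multilinear_extension_def Pow_insert
    by (subst sum.union_disjoint) (use assms in \<open>auto simp: add.commute\<close>)
  then show ?thesis using 1 2 by simp
qed

lemma multilinear_extension_cong:
  assumes "\<And>S. S \<subseteq> E \<Longrightarrow> f S = g S" "\<And>i. i \<in> E \<Longrightarrow> x i = y i"
  shows "multilinear_extension E f x = multilinear_extension E g y"
  unfolding multilinear_extension_def
  by (intro sum.cong arg_cong2[where f="(*)"] prod.cong) (use assms in auto)

lemma multilinear_extension_add:
  "multilinear_extension E (\<lambda>S. f S + g S) x = multilinear_extension E f x + multilinear_extension E g x"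
  unfolding multilinear_extension_def by (simp add: sum.distrib distrib_right)

lemma multilinear_extension_cmult:
  "multilinear_extension E (\<lambda>S. c * f S) x = c * multilinear_extension E f x"
  unfolding multilinear_extension_def by (simp add: sum_distrib_left mult.assoc)

lemma multilinear_extension_sum:
  "multilinear_extension E (\<lambda>S. \<Sum>i\<in>I. f i S) x = (\<Sum>i\<in>I. multilinear_extension E (f i) x)"
  unfolding multilinear_extension_def
  by (subst sum.swap) (simp add: sum_distrib_right)

lemma multilinear_extension_const:
  assumes "finite E"
  shows "multilinear_extension E (\<lambda>_. c) x = c"
  using assms by induction (auto simp: multilinear_extension_insert algebra_simps)

lemma multilinear_extension_mono:
  assumes "\<And>S. S \<subseteq> E \<Longrightarrow> f S \<le> g S" "\<And>i. i \<in> E \<Longrightarrow> x i \<in> {0..1}"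
  shows "multilinear_extension E f x \<le> multilinear_extension E g x"
  unfolding multilinear_extension_def
  by (intro sum_mono mult_right_mono prod_nonneg) (use assms in auto)

text \<open>Fubini for independent rounding of two disjoint blocks. As a polynomial identity it
  holds for arbitrary real \<open>x\<close>.\<close>

lemma multilinear_extension_union:
  assumes "finite K" "finite P" "K \<inter> P = {}"
  shows "multilinear_extension (K \<union> P) f x =
    multilinear_extension P (\<lambda>W. multilinear_extension K (\<lambda>U. f (U \<union> W)) x) x"
  using assms
proof (induction K arbitrary: f)
  case (insert i K)
  have "multilinear_extension (insert i (K \<union> P)) f x =
      x i * multilinear_extension P (\<lambda>W. multilinear_extension K (\<lambda>U. f (insert i (U \<union> W))) x) x +
      (1 - x i) * multilinear_extension P (\<lambda>W. multilinear_extension K (\<lambda>U. f (U \<union> W)) x) x"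
    using insert by (subst multilinear_extension_insert) auto
  with insert show ?case
    by (simp add: multilinear_extension_insert multilinear_extension_add multilinear_extension_cmult)
qed simp

lemma multilinear_extension_zero:
  assumes "finite E" "P \<subseteq> E" "\<And>i. i \<in> E - P \<Longrightarrow> x i = 0"
  shows "multilinear_extension E f x = multilinear_extension P f x"
proof -
  have "multilinear_extension (Q \<union> P) f x = multilinear_extension P f x"
    if "Q \<subseteq> E - P" "finite Q" for Q
    using that(2,1)
  proof induction
    case (insert i Q)
    have "finite P" using assms finite_subset by blast
    with insert show ?case
      using assms(3)[of i] by (auto simp: multilinear_extension_insert)
  qed simp
  from this[of "E - P"] assms show ?thesis
    by (simp add: Un_absorb2)
qed

lemma multilinear_extension_member:
  assumes "finite E" "i \<in> E"
  shows "multilinear_extension E (\<lambda>S. c * indicator S i) x = c * x i"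
proof -
  obtain F where F: "E = insert i F" "i \<notin> F" "finite F"
    using assms by (metis finite_insert mk_disjoint_insert)
  have "multilinear_extension F (\<lambda>S. c * indicator S i) x = multilinear_extension F (\<lambda>_. 0) x"
    by (rule multilinear_extension_cong) (use F in \<open>auto simp: indicator_def\<close>)
  with F show ?thesis
    by (simp add: multilinear_extension_insert multilinear_extension_const)
qed

section \<open>Submodular functions: modular examples, contraction, disjoint choices\<close>

lemma submodular_on_member: "submodular_on E (\<lambda>S. c * indicator S i)"
  unfolding submodular_on_def
  by (auto simp: indicator_def)

lemma submodular_onD:
  assumes "submodular_on E f" "e \<in> E" "S \<subseteq> T" "T \<subseteq> E" "e \<notin> T"
  shows "f (insert e T) - f T \<le> f (insert e S) - f S"
proof -
  have "T \<subseteq> E - {e}" using assms by auto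
  then show ?thesis
    using assms unfolding submodular_on_def by force
qed

text \<open>The ground set stays \<open>E\<close> instead of shrinking to \<open>E - V\<close>, so
  that it does not change along the induction over fibres. The price is the case
  \<open>e \<in> V\<close>, where both gains vanish.\<close>

lemma submodular_on_contract:
  assumes "submodular_on E f" "V \<subseteq> E"
  shows "submodular_on E (\<lambda>S. f (S \<union> V))"
  unfolding submodular_on_def
proof (intro allI impI, elim conjE)
  fix S T e assume *: "e \<in> E" "S \<subseteq> T" "T \<subseteq> E - {e}"
  show "f (T \<union> {e} \<union> V) - f (T \<union> V) \<le> f (S \<union> {e} \<union> V) - f (S \<union> V)"
  proof (cases "e \<in> V")
    case True
    then have "T \<union> {e} \<union> V = T \<union> V" "S \<union> {e} \<union> V = S \<union> V" by auto
    then show ?thesis by simp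
  next
    case False
    have "S \<union> V \<subseteq> T \<union> V" "T \<union> V \<subseteq> E" "e \<notin> T \<union> V" using * False assms(2) by auto
    from submodular_onD[OF assms(1) *(1) this] show ?thesis by (simp add: Un_assoc)
  qed
qed

text \<open>When \<open>sum x K \<le> 1\<close>, the right-hand side is the expectation of \<open>g\<close> at a random set with at
  most one element, namely \<open>i\<close> with probability \<open>x i\<close>.\<close>
lemma multilinear_extension_le_linear:
  assumes "finite K" "submodular_on K g" "\<And>i. i \<in> K \<Longrightarrow> x i \<in> {0..1}"
  shows "multilinear_extension K g x \<le> (\<Sum>i\<in>K. x i * g {i}) + (1 - (\<Sum>i\<in>K. x i)) * g {}"
proof -
  have "multilinear_extension Q g x \<le> (\<Sum>i\<in>Q. x i * g {i}) + (1 - (\<Sum>i\<in>Q. x i)) * g {}"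
    if "finite Q" "Q \<subseteq> K" for Q
    using that
  proof induction
    case (insert i Q)
    have "multilinear_extension Q (\<lambda>S. g (insert i S)) x
        \<le> multilinear_extension Q (\<lambda>S. g S + (g {i} - g {})) x"
    proof (rule multilinear_extension_mono)
      fix S assume "S \<subseteq> Q"
      then have "g (insert i S) - g S \<le> g (insert i {}) - g {}"
        using insert by (intro submodular_onD[OF assms(2)]) auto
      then show "g (insert i S) \<le> g S + (g {i} - g {})" by simp
    qed (use insert assms(3) in auto)
    also have "\<dots> = multilinear_extension Q g x + (g {i} - g {})"
      using insert by (simp add: multilinear_extension_add multilinear_extension_const)
    finally have "x i * multilinear_extension Q (\<lambda>S. g (insert i S)) x
        \<le> x i * (multilinear_extension Q g x + (g {i} - g {}))"
      using insert assms(3)[of i] by (intro mult_left_mono) auto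
    with insert show ?case
      by (simp add: multilinear_extension_insert algebra_simps)
  qed simp
  then show ?thesis using assms(1) by blast
qed

text \<open>Enlarging \<open>T\<close> by \<open>e\<close> adds at most one element to the union,
  and disjointness makes that element new, so the gain is a marginal gain of \<open>f\<close>. With
  \<open>D e\<close> the winner in fibre \<open>e\<close>, this is the function to which dominance
  of pivotal sampling is applied.\<close>

lemma submodular_on_disjoint_union:
  fixes D :: "'a \<Rightarrow> 'b set"
  assumes f: "submodular_on N f" and D: "\<And>e. e \<in> Q \<Longrightarrow> D e \<subseteq> N" "disjoint_family_on D Q"
    and single: "\<And>e. e \<in> Q \<Longrightarrow> D e = {} \<or> (\<exists>i. D e = {i})"
  shows "submodular_on Q (\<lambda>T. f (\<Union>e\<in>T. D e))"
  unfolding submodular_on_def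
proof (intro allI impI, elim conjE)
  fix S T e assume *: "e \<in> Q" "S \<subseteq> T" "T \<subseteq> Q - {e}"
  show "f (\<Union> (D ` (T \<union> {e}))) - f (\<Union> (D ` T)) \<le> f (\<Union> (D ` (S \<union> {e}))) - f (\<Union> (D ` S))"
    using single[OF *(1)]
  proof
    assume "\<exists>i. D e = {i}"
    then obtain i where i: "D e = {i}" by auto
    have "i \<notin> D e'" if "e' \<in> T" for e'
      using D(2) * i that unfolding disjoint_family_on_def by fast
    moreover have "\<Union> (D ` T) \<subseteq> N" using D(1) * by blast
    moreover have "i \<in> N" using D(1)[OF *(1)] i by simp
    moreover have "\<Union> (D ` S) \<subseteq> \<Union> (D ` T)" using * by auto
    ultimately have "f (insert i (\<Union> (D ` T))) - f (\<Union> (D ` T)) \<le> f (insert i (\<Union> (D ` S))) - f (\<Union> (D ` S))"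
      by (intro submodular_onD[OF f]) auto
    then show ?thesis using i by simp
  qed simp
qed

lemma submodular_on_subset:
  assumes "submodular_on E f" "K \<subseteq> E"
  shows "submodular_on K f"
  using assms unfolding submodular_on_def by (meson Diff_mono order.trans order_refl subsetD)


section \<open>Independence in products and exponential races\<close>

text \<open>Functions of complementary coordinate blocks are independent. Both are kept as functions
  on the whole product, with dependence expressed as invariance under changes of the other
  coordinates, so that no restriction maps appear when the lemma is applied.\<close>

lemma (in product_prob_space) integral_PiM_independent:
  fixes f g :: "('i \<Rightarrow> 'a) \<Rightarrow> real"
  assumes "finite I" "J \<subseteq> I"
    and f: "f \<in> borel_measurable (PiM I M)" "\<And>E. \<bar>f E\<bar> \<le> c"
    and g: "g \<in> borel_measurable (PiM I M)" "\<And>E. \<bar>g E\<bar> \<le> d"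
    and f_dep: "\<And>E E'. (\<And>i. i \<in> J \<Longrightarrow> E i = E' i) \<Longrightarrow> f E = f E'"
    and g_dep: "\<And>E E'. (\<And>i. i \<in> I - J \<Longrightarrow> E i = E' i) \<Longrightarrow> g E = g E'"
  shows "(LINT E|PiM I M. f E * g E) = (LINT E|PiM I M. f E) * (LINT E|PiM I M. g E)"
proof -
  \<comment> \<open>Stated for arbitrary factors because it is used three times: for
    \<open>f\<close> and \<open>g\<close>, and with one of them replaced by the constant 1, which
    identifies the integrals over \<open>PiM J M\<close> and \<open>PiM (I - J) M\<close> with those
    over \<open>PiM I M\<close>.\<close>
  have prod: "(LINT E|PiM I M. f E * g E) = (LINT E|PiM J M. f E) * (LINT E|PiM (I - J) M. g E)"
    if f: "f \<in> borel_measurable (PiM I M)" "\<And>E. \<bar>f E\<bar> \<le> c"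
      and g: "g \<in> borel_measurable (PiM I M)" "\<And>E. \<bar>g E\<bar> \<le> d"
      and f_dep: "\<And>E E'. (\<And>i. i \<in> J \<Longrightarrow> E i = E' i) \<Longrightarrow> f E = f E'"
      and g_dep: "\<And>E E'. (\<And>i. i \<in> I - J \<Longrightarrow> E i = E' i) \<Longrightarrow> g E = g E'"
    for f g :: "('i \<Rightarrow> 'a) \<Rightarrow> real" and c d
  proof -
    interpret P: prob_space "PiM I M" by (intro prob_space_PiM prob_space)
    have I: "J \<union> (I - J) = I" using assms(2) by auto
    have fin: "finite J" using assms finite_subset by blast
    have "0 \<le> c" using f(2) abs_ge_zero order.trans by blast
    then have "\<bar>f E * g E\<bar> \<le> c * d" for E
      unfolding abs_mult by (intro mult_mono f g) auto
    then have "integrable (PiM (J \<union> (I - J)) M) (\<lambda>E. f E * g E)"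
      using f g unfolding I by (intro P.integrable_const_bound[where B="c * d"]) auto
    then have "(LINT E|PiM (J \<union> (I - J)) M. f E * g E) =
        (LINT x|PiM J M. LINT y|PiM (I - J) M.
          f (merge J (I - J) (x, y)) * g (merge J (I - J) (x, y)))"
      using fin assms(1) by (intro product_integral_fold) auto
    also have "\<dots> = (LINT x|PiM J M. LINT y|PiM (I - J) M. f x * g y)"
    proof -
      \<comment> \<open>A point \<open>x\<close> of the smaller product is in general no point of
        \<open>PiM I M\<close>. This is why the dependence assumptions range over all functions and
        not just over the space.\<close>
      have "f (merge J (I - J) (x, y)) = f x" "g (merge J (I - J) (x, y)) = g y" for x y
        by (rule f_dep g_dep; simp add: merge_def)+
      then show ?thesis by simp
    qed
    finally show ?thesis unfolding I by simp
  qed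
  interpret J: prob_space "PiM J M" by (intro prob_space_PiM prob_space)
  interpret K: prob_space "PiM (I - J) M" by (intro prob_space_PiM prob_space)
  have "(LINT E|PiM I M. f E) = (LINT E|PiM J M. f E)"
    using prod[OF f, of "\<lambda>_. 1" 1, OF _ _ f_dep] by (simp add: K.prob_space)
  moreover have "(LINT E|PiM I M. g E) = (LINT E|PiM (I - J) M. g E)"
    using prod[OF _ _ g, of "\<lambda>_. 1" 1, OF _ _ _ g_dep] by (simp add: J.prob_space)
  ultimately show ?thesis using prod[OF f g f_dep g_dep] by simp
qed

text \<open>Freezing: split according to the finitely many values of \<open>g\<close>; on each piece
  the indicator of \<open>g E = r\<close> lives on \<open>J\<close> and \<open>F r\<close> on
  \<open>I - J\<close>, so they are independent.\<close>

lemma (in product_prob_space) integral_PiM_compose: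
  fixes F :: "'r \<Rightarrow> ('i \<Rightarrow> 'a) \<Rightarrow> real"
  assumes "finite I" "J \<subseteq> I" "finite R" "\<And>E. g E \<in> R"
    and g: "\<And>r. {E \<in> space (PiM I M). g E = r} \<in> sets (PiM I M)"
    and g_dep: "\<And>E E'. (\<And>i. i \<in> J \<Longrightarrow> E i = E' i) \<Longrightarrow> g E = g E'"
    and F: "\<And>r. r \<in> R \<Longrightarrow> F r \<in> borel_measurable (PiM I M)" "\<And>r E. r \<in> R \<Longrightarrow> \<bar>F r E\<bar> \<le> B r"
    and F_dep: "\<And>r E E'. r \<in> R \<Longrightarrow> (\<And>i. i \<in> I - J \<Longrightarrow> E i = E' i) \<Longrightarrow> F r E = F r E'"
  shows "(LINT E|PiM I M. F (g E) E) =
    (\<Sum>r\<in>R. measure (PiM I M) {E \<in> space (PiM I M). g E = r} * (LINT E|PiM I M. F r E))"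
proof -
  interpret P: prob_space "PiM I M" by (intro prob_space_PiM prob_space)
  \<comment> \<open>The indicator of the event as a subset of the space would also test membership
    in the space, which involves every coordinate; \<open>?b\<close> depends on \<open>J\<close>
    alone. The two agree on the space, which suffices for measurability and integrals.\<close>
  let ?b = "\<lambda>r E. of_bool (g E = r) :: real"
  let ?I = "\<lambda>r E. indicator {E \<in> space (PiM I M). g E = r} E :: real"
  have split: "F (g E) E = (\<Sum>r\<in>R. ?b r E * F r E)" for E
  proof -
    have "(\<Sum>r\<in>R. ?b r E * F r E) = (\<Sum>r\<in>{g E}. ?b r E * F r E)"
      using assms(3,4) by (intro sum.mono_neutral_right) auto
    then show ?thesis by simp
  qed
  have meas: "?b r \<in> borel_measurable (PiM I M)" for r
  proof -
    have "?b r \<in> borel_measurable (PiM I M) \<longleftrightarrow> ?I r \<in> borel_measurable (PiM I M)"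
      by (rule measurable_cong) (simp add: indicator_def)
    then show ?thesis using g by simp
  qed
  have int: "(LINT E|PiM I M. ?b r E) = measure (PiM I M) {E \<in> space (PiM I M). g E = r}" for r
  proof -
    have "(LINT E|PiM I M. ?b r E) = (LINT E|PiM I M. ?I r E)"
      by (rule Bochner_Integration.integral_cong) (auto simp: indicator_def)
    then show ?thesis using g[of r] by simp
  qed
  have "(LINT E|PiM I M. ?b r E * F r E) = (LINT E|PiM I M. ?b r E) * (LINT E|PiM I M. F r E)"
    if "r \<in> R" for r
  proof (rule integral_PiM_independent[where c=1, OF assms(1,2) meas _ F(1,2)[OF that]])
    fix E E' :: "'i \<Rightarrow> 'a" assume "\<And>i. i \<in> J \<Longrightarrow> E i = E' i"
    then have "g E = g E'" by (rule g_dep)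
    then show "?b r E = ?b r E'" by simp
  next
    fix E E' :: "'i \<Rightarrow> 'a" assume "\<And>i. i \<in> I - J \<Longrightarrow> E i = E' i"
    then show "F r E = F r E'" by (rule F_dep[OF that])
  qed simp
  moreover have "integrable (PiM I M) (\<lambda>E. ?b r E * F r E)" if "r \<in> R" for r
  proof (rule P.integrable_const_bound)
    show "AE E in PiM I M. norm (?b r E * F r E) \<le> B r"
      using F(2)[OF that] order.trans[OF abs_ge_zero F(2)[OF that]] by (intro AE_I2) (auto simp: of_bool_def)
  qed (intro borel_measurable_times meas F(1) that)
  ultimately show ?thesis unfolding split using int by simp
qed

text \<open>The tower property, from two uses of the freezing formula: once for \<open>F\<close>,
  once for the constant functions \<open>h r\<close>.\<close>

lemma (in product_prob_space) integral_PiM_condition: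
  fixes F :: "'r \<Rightarrow> ('i \<Rightarrow> 'a) \<Rightarrow> real"
  assumes "finite I" "J \<subseteq> I" "finite R" "\<And>E. g E \<in> R"
    and "\<And>r. {E \<in> space (PiM I M). g E = r} \<in> sets (PiM I M)"
    and "\<And>E E'. (\<And>i. i \<in> J \<Longrightarrow> E i = E' i) \<Longrightarrow> g E = g E'"
    and "\<And>r. r \<in> R \<Longrightarrow> F r \<in> borel_measurable (PiM I M)" "\<And>r E. r \<in> R \<Longrightarrow> \<bar>F r E\<bar> \<le> B r"
    and "\<And>r E E'. r \<in> R \<Longrightarrow> (\<And>i. i \<in> I - J \<Longrightarrow> E i = E' i) \<Longrightarrow> F r E = F r E'"
    and h: "\<And>r. r \<in> R \<Longrightarrow> (LINT E|PiM I M. F r E) = h r"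
  shows "(LINT E|PiM I M. F (g E) E) = (LINT E|PiM I M. h (g E))"
proof -
  interpret P: prob_space "PiM I M" by (intro prob_space_PiM prob_space)
  have "(LINT E|PiM I M. F (g E) E) =
      (\<Sum>r\<in>R. measure (PiM I M) {E \<in> space (PiM I M). g E = r} * h r)"
    using h by (subst integral_PiM_compose[where F=F and B=B, OF assms(1-9)]) auto
  also have "\<dots> = (LINT E|PiM I M. h (g E))"
    using integral_PiM_compose[where F="\<lambda>r _. h r" and B="\<lambda>r. \<bar>h r\<bar>", OF assms(1-6)]
    by (simp add: P.prob_space)
  finally show ?thesis .
qed

section \<open>Choice and measurability of a minimizer\<close>

definition minimizers :: "('a \<Rightarrow> 'b :: linorder) \<Rightarrow> 'a set \<Rightarrow> 'a set" where
  "minimizers f K = {i \<in> K. \<forall>j\<in>K. f i \<le> f j}"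

text \<open>Even under ties the choice made by \<open>arg_min_on\<close> depends on the objective
  only through its set of minimizers. Rescaling the objective or altering it off \<open>K\<close>
  therefore leaves the winner exactly the same, not just almost surely.\<close>

lemma arg_min_on_minimizers: "arg_min_on f K = (SOME i. i \<in> minimizers f K)"
  unfolding arg_min_on_def arg_min_def is_arg_min_linorder minimizers_def Ball_def by simp

lemma arg_min_on_mem:
  assumes "finite K" "K \<noteq> {}"
  shows "arg_min_on f K \<in> minimizers f K"
proof -
  have "Min (f ` K) \<in> f ` K" using assms by simp
  then obtain i where "i \<in> K" "f i = Min (f ` K)" by auto
  then have "i \<in> minimizers f K" using assms by (simp add: minimizers_def)
  then show ?thesis unfolding arg_min_on_minimizers by (rule someI)
qed

lemma arg_min_on_in:
  fixes f :: "'a \<Rightarrow> 'b :: linorder"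
  assumes "finite K" "K \<noteq> {}"
  shows "arg_min_on f K \<in> K"
  using arg_min_on_mem[OF assms, of f] by (simp add: minimizers_def)

lemma measurable_into_Pow:
  assumes "finite N" "\<And>\<omega>. \<omega> \<in> space M \<Longrightarrow> X \<omega> \<subseteq> N"
    and "\<And>i. i \<in> N \<Longrightarrow> {\<omega> \<in> space M. i \<in> X \<omega>} \<in> sets M"
  shows "X \<in> measurable M (count_space (Pow N))"
proof (rule measurable_count_space_eq2[THEN iffD2])
  show "X \<in> space M \<rightarrow> Pow N \<and> (\<forall>V\<in>Pow N. X -` {V} \<inter> space M \<in> sets M)"
  proof (intro conjI ballI)
    fix V assume "V \<in> Pow N"
    then have "X -` {V} \<inter> space M = {\<omega> \<in> space M. \<forall>i\<in>N. i \<in> X \<omega> \<longleftrightarrow> i \<in> V}"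
      using assms(2) by blast
    also have "\<dots> \<in> sets M"
    proof (rule sets.sets_Collect_finite_All[OF _ assms(1)])
      fix i assume "i \<in> N"
      then show "{\<omega> \<in> space M. i \<in> X \<omega> \<longleftrightarrow> i \<in> V} \<in> sets M"
        using assms(3)[of i] by (cases "i \<in> V") (auto intro: sets.sets_Collect_neg)
    qed
    finally show "X -` {V} \<inter> space M \<in> sets M" .
  qed (use assms(2) in auto)
qed (use assms in simp)

text \<open>The set of minimizers is a measurable variable with finitely many values, cut out by
  finitely many comparisons, and any choice function on a discrete space is measurable.\<close>

lemma measurable_arg_min_on:
  fixes f :: "'w \<Rightarrow> 'i \<Rightarrow> real"
  assumes "finite K" "\<And>i. i \<in> K \<Longrightarrow> (\<lambda>\<omega>. f \<omega> i) \<in> borel_measurable M"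
  shows "(\<lambda>\<omega>. arg_min_on (f \<omega>) K) \<in> measurable M (count_space UNIV)"
proof -
  have "(\<lambda>\<omega>. minimizers (f \<omega>) K) \<in> measurable M (count_space (Pow K))"
  proof (rule measurable_into_Pow)
    fix i assume "i \<in> K"
    have "{\<omega> \<in> space M. i \<in> minimizers (f \<omega>) K} = {\<omega> \<in> space M. \<forall>j\<in>K. f \<omega> i \<le> f \<omega> j}"
      using \<open>i \<in> K\<close> by (auto simp: minimizers_def)
    also have "\<dots> \<in> sets M"
      using assms \<open>i \<in> K\<close> by (intro sets.sets_Collect_finite_All borel_measurable_le) auto
    finally show "{\<omega> \<in> space M. i \<in> minimizers (f \<omega>) K} \<in> sets M" .
  qed (use assms in \<open>auto simp: minimizers_def\<close>)
  from measurable_compose[OF this, of "\<lambda>V. SOME i. i \<in> V" "count_space UNIV"]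
  show ?thesis by (simp add: arg_min_on_minimizers)
qed

section \<open>Exponential clocks\<close>

abbreviation exp1 :: "real measure" where
  "exp1 \<equiv> density lborel (\<lambda>t. ennreal (exponential_density 1 t))"

lemma prob_space_exp1: "prob_space exp1"
  using prob_space_exponential_density[of 1] by simp

lemma emeasure_exp1_greaterThan:
  assumes "0 \<le> a"
  shows "emeasure exp1 {a<..} = ennreal (exp (- a))"
proof -
  interpret prob_space exp1 by (rule prob_space_exp1)
  have "distributed exp1 lborel (\<lambda>x. x) (exponential_density 1)"
    unfolding distributed_def by (auto simp: distr_id2 exponential_density_nonneg)
  then have "prob {x \<in> space exp1. a < x} = exp (- a * 1)"
    by (rule exponential_distributedD_gt) (use assms in auto)
  moreover have "{x \<in> space exp1. a < x} = {a<..}" by auto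
  ultimately show ?thesis by (simp add: emeasure_eq_measure)
qed

text \<open>The Laplace transform of Exp(1): the integrand is \<open>1 / (1 + c)\<close> times the
  density with rate \<open>1 + c\<close>.\<close>

lemma nn_integral_exp1_exp:
  assumes "0 \<le> c"
  shows "(\<integral>\<^sup>+y. ennreal (exp (- c * y)) \<partial>exp1) = ennreal (1 / (1 + c))"
proof -
  have "(\<integral>\<^sup>+y. ennreal (exp (- c * y)) \<partial>exp1) =
      (\<integral>\<^sup>+y. ennreal (exponential_density 1 y) * ennreal (exp (- c * y)) \<partial>lborel)"
    by (rule nn_integral_density) auto
  also have "\<dots> = (\<integral>\<^sup>+y. ennreal (1 / (1 + c)) * ennreal (exponential_density (1 + c) y) \<partial>lborel)"
  proof (rule nn_integral_cong)
    fix y :: real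
    show "ennreal (exponential_density 1 y) * ennreal (exp (- c * y)) =
        ennreal (1 / (1 + c)) * ennreal (exponential_density (1 + c) y)"
      using assms by (auto simp: exponential_density_def ennreal_mult[symmetric] mult_exp_exp field_simps add_eq_0_iff)
  qed
  also have "\<dots> = ennreal (1 / (1 + c)) * (\<integral>\<^sup>+y. ennreal (exponential_density (1 + c) y) \<partial>lborel)"
    by (rule nn_integral_cmult) auto
  also have "(\<integral>\<^sup>+y. ennreal (exponential_density (1 + c) y) \<partial>lborel) = 1"
    using prob_space.emeasure_space_1[OF prob_space_exponential_density[of "1 + c"]] assms
    by (simp add: emeasure_density)
  finally show ?thesis by simp
qed

text \<open>The strict minimum is attained at \<open>i\<close> with probability \<open>x i / sum x K\<close>; these numbers add up
  to 1, so ties do not matter.\<close>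
lemma exponential_race:
  assumes "finite I" "K \<subseteq> I" "\<And>i. i \<in> K \<Longrightarrow> 0 < x i" "i \<in> K"
  shows "measure (PiM I (\<lambda>_. exp1)) {E \<in> space (PiM I (\<lambda>_. exp1)). arg_min_on (\<lambda>j. E j / x j) K = i} =
    x i / sum x K"
proof -
  interpret product_prob_space "\<lambda>_. exp1" I
    by (intro product_prob_spaceI prob_space_exp1)
  interpret P: prob_space "PiM I (\<lambda>_. exp1)" by (intro prob_space_PiM prob_space)
  let ?P = "PiM I (\<lambda>_. exp1)"
  let ?A = "\<lambda>i. {E \<in> space ?P. arg_min_on (\<lambda>j. E j / x j) K = i}"
  have finK: "finite K" using assms finite_subset by blast
  have sumpos: "0 < sum x K" using assms finK by (intro sum_pos) auto
  have sets_A: "?A i \<in> sets ?P" for i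
  proof -
    have "(\<lambda>E. arg_min_on (\<lambda>j. E j / x j) K) \<in> measurable ?P (count_space UNIV)"
      using assms by (intro measurable_arg_min_on finK borel_measurable_divide) auto
    then show ?thesis by measurable
  qed
  have ge: "x i / sum x K \<le> measure ?P (?A i)" if i: "i \<in> K" for i
  proof -
    \<comment> \<open>If clock \<open>i\<close> shows \<open>y\<close>, competitor \<open>j\<close>
      loses with probability \<open>exp (- y * x j / x i)\<close>. The product over the competitors
      is \<open>exp (- c * y)\<close>, and integrating over \<open>y\<close> gives
      \<open>1 / (1 + c) = x i / sum x K\<close>.\<close>
    define c where "c = (\<Sum>j\<in>K - {i}. x j) / x i"
    have xi: "0 < x i" using assms i by simp
    have c: "0 \<le> c" unfolding c_def using assms(3) xi by (intro divide_nonneg_pos sum_nonneg) (auto intro: less_imp_le)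
    have I: "insert i (I - {i}) = I" using assms(2) i by auto
    let ?B = "{E \<in> space ?P. \<forall>j\<in>K - {i}. E i / x i < E j / x j}"
    have sets_B: "?B \<in> sets ?P"
      using assms i finK by (intro sets.sets_Collect_finite_All borel_measurable_less borel_measurable_divide) auto
    have "?B \<subseteq> ?A i"
    proof safe
      fix E assume *: "\<forall>j\<in>K - {i}. E i / x i < E j / x j"
      have "arg_min_on (\<lambda>j. E j / x j) K \<in> minimizers (\<lambda>j. E j / x j) K"
        using i finK by (intro arg_min_on_mem) auto
      then have "arg_min_on (\<lambda>j. E j / x j) K \<in> K" "\<not> E i / x i < E (arg_min_on (\<lambda>j. E j / x j) K) / x (arg_min_on (\<lambda>j. E j / x j) K)"
        using i by (auto simp: minimizers_def not_less)
      with * show "arg_min_on (\<lambda>j. E j / x j) K = i" by blast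
    qed
    have "ennreal (1 / (1 + c)) = (\<integral>\<^sup>+y. ennreal (exp (- c * y)) \<partial>exp1)"
      using c by (rule nn_integral_exp1_exp[symmetric])
    also have "\<dots> \<le> (\<integral>\<^sup>+y. (\<integral>\<^sup>+E. indicator ?B (E(i := y)) \<partial>PiM (I - {i}) (\<lambda>_. exp1)) \<partial>exp1)"
    proof (rule nn_integral_mono_AE)
      have "AE y in exp1. 0 \<le> y"
        by (subst AE_density) (auto simp: exponential_density_def)
      then show "AE y in exp1. ennreal (exp (- c * y)) \<le>
          (\<integral>\<^sup>+E. indicator ?B (E(i := y)) \<partial>PiM (I - {i}) (\<lambda>_. exp1))"
      proof eventually_elim
        fix y :: real assume y: "0 \<le> y"
        \<comment> \<open>Clocks outside \<open>K\<close> are unconstrained and contribute the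
          factor 1, so the event becomes a box in all clocks other than \<open>i\<close>.\<close>
        let ?X = "\<lambda>j. if j \<in> K then {y * x j / x i<..} else UNIV"
        have "ennreal (exp (- c * y)) = (\<Prod>j\<in>K - {i}. ennreal (exp (- (y * x j / x i))))"
        proof -
          have "- c * y = (\<Sum>j\<in>K - {i}. - (y * x j / x i))"
            unfolding c_def by (simp add: sum_negf sum_divide_distrib sum_distrib_left mult.commute)
          then have "exp (- c * y) = (\<Prod>j\<in>K - {i}. exp (- (y * x j / x i)))"
            using finK by (simp add: exp_sum)
          then show ?thesis by (simp add: prod_ennreal)
        qed
        also have "\<dots> = (\<Prod>j\<in>K - {i}. emeasure exp1 (?X j))"
          using y xi assms(3) by (intro prod.cong refl) (auto simp: emeasure_exp1_greaterThan less_imp_le)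
        also have "\<dots> = (\<Prod>j\<in>I - {i}. emeasure exp1 (?X j))"
        proof (rule prod.mono_neutral_left)
          have "emeasure exp1 UNIV = 1"
            using prob_space.emeasure_space_1[OF prob_space_exp1] by simp
          then show "\<forall>j\<in>I - {i} - (K - {i}). emeasure exp1 (?X j) = 1" by auto
        qed (use assms in auto)
        also have "\<dots> = emeasure (PiM (I - {i}) (\<lambda>_. exp1)) (PiE (I - {i}) ?X)"
          using assms(1) by (intro emeasure_PiM[symmetric]) auto
        also have "\<dots> = (\<integral>\<^sup>+E. indicator (PiE (I - {i}) ?X) E \<partial>PiM (I - {i}) (\<lambda>_. exp1))"
          using assms(1) by (intro nn_integral_indicator[symmetric] sets_PiM_I_finite) auto
        also have "\<dots> \<le> (\<integral>\<^sup>+E. indicator ?B (E(i := y)) \<partial>PiM (I - {i}) (\<lambda>_. exp1))"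
        proof (rule nn_integral_mono)
          fix E assume E: "E \<in> space (PiM (I - {i}) (\<lambda>_. exp1))"
          have "E(i := y) \<in> ?B" if "E \<in> PiE (I - {i}) ?X"
          proof -
            have "E(i := y) \<in> space ?P"
              using E i assms(2) by (auto simp: space_PiM PiE_def extensional_def)
            moreover have "y / x i < E j / x j" if "j \<in> K - {i}" for j
            proof -
              have "y * x j / x i < E j"
                using \<open>E \<in> PiE (I - {i}) ?X\<close> that assms(2) by (auto dest!: PiE_mem[of _ _ _ j])
              then show ?thesis using xi assms(3)[of j] that by (simp add: field_simps)
            qed
            ultimately show ?thesis by auto
          qed
          then show "(indicator (PiE (I - {i}) ?X) E :: ennreal) \<le> indicator ?B (E(i := y))"
            by (auto simp: indicator_def)
        qed
        finally show "ennreal (exp (- c * y)) \<le>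
          (\<integral>\<^sup>+E. indicator ?B (E(i := y)) \<partial>PiM (I - {i}) (\<lambda>_. exp1))" .
      qed
    qed
    also have "\<dots> = (\<integral>\<^sup>+E. indicator ?B E \<partial>PiM (insert i (I - {i})) (\<lambda>_. exp1))"
      using assms(1) sets_B by (subst product_nn_integral_insert_rev) (auto simp: I insert_absorb[of i I] subsetD[OF assms(2) i])
    also have "\<dots> = emeasure ?P ?B"
      using sets_B unfolding I by (rule nn_integral_indicator)
    also have "\<dots> \<le> emeasure ?P (?A i)"
      using \<open>?B \<subseteq> ?A i\<close> sets_A by (rule emeasure_mono)
    finally have "1 / (1 + c) \<le> measure ?P (?A i)"
      by (simp add: P.emeasure_eq_measure)
    moreover have "1 / (1 + c) = x i / sum x K"
      using xi i finK by (simp add: c_def field_simps sum.remove[of K i x])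
    ultimately show ?thesis by simp
  qed
  have "(\<Sum>i\<in>K. measure ?P (?A i)) = measure ?P (\<Union>i\<in>K. ?A i)"
    using finK sets_A by (intro P.finite_measure_finite_Union[symmetric]) (auto simp: disjoint_family_on_def)
  also have "\<dots> \<le> 1" by simp
  also have "1 = (\<Sum>i\<in>K. x i / sum x K)"
    using sumpos by (simp add: sum_divide_distrib[symmetric])
  finally have le: "(\<Sum>i\<in>K. measure ?P (?A i) - x i / sum x K) \<le> 0"
    by (simp add: sum_subtractf)
  \<comment> \<open>All slacks are nonnegative and their sum is at most 0, so each of them
    vanishes.\<close>
  have "measure ?P (?A i) - x i / sum x K \<le> (\<Sum>i\<in>K. measure ?P (?A i) - x i / sum x K)"
    using assms(4) finK ge by (intro member_le_sum) auto
  with le ge[OF assms(4)] show ?thesis by linarith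
qed


section \<open>Rounding by independent races\<close>

text \<open>The rates are left unnormalized, since a common factor does not change the winner. A
  large element becomes a race with a single runner, so buckets and large elements are treated
  alike. The empty case is separate because \<open>arg_min_on\<close> on an empty set yields an
  arbitrary value.\<close>

definition race :: "('i \<Rightarrow> real) \<Rightarrow> ('i \<Rightarrow> real) \<Rightarrow> 'i set \<Rightarrow> 'i set" where
  "race x E K = (if K = {} then {} else {arg_min_on (\<lambda>i. E i / x i) K})"

lemma race_subset: "finite K \<Longrightarrow> race x E K \<subseteq> K"
  using arg_min_on_in[of K] by (auto simp: race_def)

lemma race_cong:
  assumes "\<And>i. i \<in> K \<Longrightarrow> E i = E' i"
  shows "race x E K = race x E' K"
proof -
  have "minimizers (\<lambda>i. E i / x i) K = minimizers (\<lambda>i. E' i / x i) K"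
    using assms by (auto simp: minimizers_def)
  then show ?thesis by (simp add: race_def arg_min_on_minimizers)
qed

lemma sets_mem_race:
  assumes "finite I" "K \<subseteq> I"
  shows "{E \<in> space (PiM I (\<lambda>_. exp1)). i \<in> race x E K} \<in> sets (PiM I (\<lambda>_. exp1))"
proof (cases "K = {}")
  case False
  have "finite K" using assms finite_subset by blast
  then have "(\<lambda>E. arg_min_on (\<lambda>j. E j / x j) K) \<in> measurable (PiM I (\<lambda>_. exp1)) (count_space UNIV)"
    using assms by (intro measurable_arg_min_on borel_measurable_divide) auto
  then have "{E \<in> space (PiM I (\<lambda>_. exp1)). arg_min_on (\<lambda>j. E j / x j) K = i} \<in> sets (PiM I (\<lambda>_. exp1))"
    by measurable
  then show ?thesis using False by (simp add: race_def eq_commute)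
qed (simp add: race_def)

lemma measurable_race_union:
  assumes "finite I" "finite T" "V \<subseteq> I" "\<And>e. e \<in> T \<Longrightarrow> K e \<subseteq> I"
  shows "(\<lambda>E. V \<union> (\<Union>e\<in>T. race x E (K e))) \<in> measurable (PiM I (\<lambda>_. exp1)) (count_space (Pow I))"
proof (rule measurable_into_Pow[OF assms(1)])
  fix E show "V \<union> (\<Union>e\<in>T. race x E (K e)) \<subseteq> I"
    using assms race_subset[of _ x E] finite_subset[OF _ assms(1)] by blast
next
  fix i
  have "{E \<in> space (PiM I (\<lambda>_. exp1)). i \<in> V \<union> (\<Union>e\<in>T. race x E (K e))} =
      {E \<in> space (PiM I (\<lambda>_. exp1)). i \<in> V \<or> (\<exists>e\<in>T. i \<in> race x E (K e))}"
    by auto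
  also have "\<dots> \<in> sets (PiM I (\<lambda>_. exp1))"
    using assms by (intro sets.sets_Collect_disj sets.sets_Collect_finite_Ex sets_mem_race) auto
  finally show "{E \<in> space (PiM I (\<lambda>_. exp1)). i \<in> V \<union> (\<Union>e\<in>T. race x E (K e))} \<in> sets (PiM I (\<lambda>_. exp1))" .
qed

lemma bounded_on_Pow:
  fixes f :: "'a set \<Rightarrow> real"
  assumes "finite N"
  obtains B where "\<And>S. S \<subseteq> N \<Longrightarrow> \<bar>f S\<bar> \<le> B"
proof
  fix S assume "S \<subseteq> N"
  then show "\<bar>f S\<bar> \<le> Max ((\<lambda>S. \<bar>f S\<bar>) ` Pow N)" using assms by (intro Max_ge) auto
qed

lemma abs_multilinear_extension_le:
  assumes "finite E" "\<And>S. S \<subseteq> E \<Longrightarrow> \<bar>f S\<bar> \<le> B" "\<And>i. i \<in> E \<Longrightarrow> x i \<in> {0..1}"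
  shows "\<bar>multilinear_extension E f x\<bar> \<le> B"
proof -
  have "f S \<le> B" "- B \<le> f S" if "S \<subseteq> E" for S
    using assms(2)[OF that] by auto
  then have "multilinear_extension E f x \<le> multilinear_extension E (\<lambda>_. B) x"
    and "multilinear_extension E (\<lambda>_. - B) x \<le> multilinear_extension E f x"
    using assms(3) by (auto intro!: multilinear_extension_mono)
  then show ?thesis using assms(1) by (simp add: multilinear_extension_const)
qed

lemma borel_measurable_multilinear_extension:
  assumes "finite Q" "\<And>T. T \<subseteq> Q \<Longrightarrow> (\<lambda>\<omega>. g \<omega> T) \<in> borel_measurable M"
  shows "(\<lambda>\<omega>. multilinear_extension Q (g \<omega>) s) \<in> borel_measurable M"
  unfolding multilinear_extension_def
  by (intro borel_measurable_sum borel_measurable_times borel_measurable_const) (use assms in auto)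

text \<open>Conditioning on the independent winner of one race, the induction hypothesis applies to the
  contraction of \<open>f\<close> by that winner.\<close>
lemma race_rounding:
  assumes "finite I" "finite Q" "disjoint_family_on K Q"
    and "\<And>e. e \<in> Q \<Longrightarrow> K e \<subseteq> I" "\<And>e i. e \<in> Q \<Longrightarrow> i \<in> K e \<Longrightarrow> 0 < x i"
    and "\<And>e. e \<in> Q \<Longrightarrow> sum x (K e) \<le> 1" "submodular_on I f"
  shows "multilinear_extension (\<Union>e\<in>Q. K e) f x \<le>
    (LINT E|PiM I (\<lambda>_. exp1). multilinear_extension Q (\<lambda>T. f (\<Union>e\<in>T. race x E (K e))) (\<lambda>e. sum x (K e)))"
  using assms(2-)
proof (induction Q arbitrary: f)
  interpret product_prob_space "\<lambda>_. exp1" I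
    by (intro product_prob_spaceI prob_space_exp1)
  interpret P: prob_space "PiM I (\<lambda>_. exp1)" by (intro prob_space_PiM prob_space)
  {
    case empty
    then show ?case by (simp add: P.prob_space)
  next
    case (insert b Q)
    let ?P = "PiM I (\<lambda>_. exp1)"
    let ?s = "\<lambda>e. sum x (K e)"
    \<comment> \<open>The value when fibre \<open>b\<close> contributes the fixed set
      \<open>V\<close>, the other fibres are selected independently and their races are run with
      clocks \<open>E\<close>.\<close>
    define H where "H = (\<lambda>V E. multilinear_extension Q (\<lambda>T. f (V \<union> (\<Union>e\<in>T. race x E (K e)))) ?s)"
    have disj: "disjoint_family_on K Q" "K b \<inter> (\<Union>e\<in>Q. K e) = {}"
      using insert.prems(1) insert.hyps(2) by (auto simp: disjoint_family_on_def)
    have finK: "finite (K e)" if "e \<in> insert b Q" for e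
      using insert.prems(2)[OF that] assms(1) finite_subset by blast
    have s: "?s e \<in> {0..1}" if "e \<in> insert b Q" for e
      using insert.prems(4)[OF that] sum_nonneg[of "K e" x] insert.prems(3)[OF that]
      by (auto simp: less_imp_le)
    have IH: "multilinear_extension (\<Union>e\<in>Q. K e) (\<lambda>W. f (V \<union> W)) x \<le> (LINT E|?P. H V E)" if "V \<subseteq> I" for V
      unfolding H_def using insert.prems disj submodular_on_contract[OF insert.prems(5) that]
      by (intro insert.IH) (auto simp: Un_commute)
    obtain B where B: "\<And>S. S \<subseteq> I \<Longrightarrow> \<bar>f S\<bar> \<le> B" using bounded_on_Pow[OF assms(1)] by blast
    have H_bound: "\<bar>H V E\<bar> \<le> B" if "V \<subseteq> I" for V E
      unfolding H_def
    proof (intro abs_multilinear_extension_le B)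
      fix T assume "T \<subseteq> Q"
      then have "race x E (K e) \<subseteq> I" if "e \<in> T" for e
        using race_subset[OF finK, of e x E] insert.prems(2)[of e] that by blast
      then show "V \<union> (\<Union>e\<in>T. race x E (K e)) \<subseteq> I" using \<open>V \<subseteq> I\<close> by blast
    qed (use insert s in auto)
    have H_meas: "H V \<in> borel_measurable ?P" if "V \<subseteq> I" for V
      unfolding H_def
    proof (intro borel_measurable_multilinear_extension insert)
      fix T assume "T \<subseteq> Q"
      then have "finite T" using insert finite_subset by blast
      then have "(\<lambda>E. V \<union> (\<Union>e\<in>T. race x E (K e))) \<in> measurable ?P (count_space (Pow I))"
        using assms(1) that \<open>T \<subseteq> Q\<close> insert.prems(2) by (intro measurable_race_union) auto
      then show "(\<lambda>E. f (V \<union> (\<Union>e\<in>T. race x E (K e)))) \<in> borel_measurable ?P"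
        by (rule measurable_compose) simp
    qed
    have H_int: "integrable ?P (H V)" if "V \<subseteq> I" for V
      using H_bound[OF that] H_meas[OF that] by (intro P.integrable_const_bound[where B=B]) auto
    have expand: "multilinear_extension (insert b Q) (\<lambda>T. f (\<Union>e\<in>T. race x E (K e))) ?s =
        ?s b * H (race x E (K b)) E + (1 - ?s b) * H {} E" for E
      unfolding H_def using insert.hyps by (simp add: multilinear_extension_insert)
    show ?case
    \<comment> \<open>An empty fibre has weight 0 and contributes nothing; otherwise its weight is
      positive and may be divided by.\<close>
    proof (cases "K b = {}")
      case True
      then show ?thesis using IH[of "{}"] by (simp add: expand)
    next
      case False
      let ?w = "\<lambda>E. arg_min_on (\<lambda>i. E i / x i) (K b)"
      have spos: "0 < ?s b"
        using insert.prems(3) finK False by (intro sum_pos) auto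
      have Kb: "K b \<subseteq> I" using insert.prems(2) by simp
      have w_set: "{E \<in> space ?P. ?w E = i} \<in> sets ?P" for i
        using sets_mem_race[OF assms(1) Kb, of i x] False by (simp add: race_def eq_commute)
      have w_mem: "?w E \<in> K b" for E
        using arg_min_on_in[OF finK False] by simp
      \<comment> \<open>The winner in \<open>K b\<close> is a function of the clocks in
        \<open>K b\<close>, and \<open>H {i}\<close> of the clocks in the other, disjoint fibres.
        The winner may thus be frozen.\<close>
      have w_int: "(LINT E|?P. H {?w E} E) = (\<Sum>i\<in>K b. (x i / ?s b) * (LINT E|?P. H {i} E))"
      proof -
        have "(LINT E|?P. H {?w E} E) =
            (\<Sum>i\<in>K b. measure ?P {E \<in> space ?P. ?w E = i} * (LINT E|?P. H {i} E))"
        proof (rule integral_PiM_compose[where B="\<lambda>_. B", OF assms(1) Kb _ _ w_set])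
          fix E E' :: "'a \<Rightarrow> real" assume "\<And>j. j \<in> K b \<Longrightarrow> E j = E' j"
          then have "race x E (K b) = race x E' (K b)" by (rule race_cong)
          then show "?w E = ?w E'" using False by (simp add: race_def)
        next
          fix i and E E' :: "'a \<Rightarrow> real" assume *: "\<And>j. j \<in> I - K b \<Longrightarrow> E j = E' j"
          have "race x E (K e) = race x E' (K e)" if "e \<in> Q" for e
            using insert.prems(2)[of e] disj(2) that by (intro race_cong *) auto
          then show "H {i} E = H {i} E'"
            unfolding H_def by (intro multilinear_extension_cong arg_cong[where f=f]) auto
        qed (use finK Kb w_mem H_meas H_bound in auto)
        then show ?thesis
          using exponential_race[OF assms(1) Kb insert.prems(3)[OF insertI1]] by simp
      qed
      have "integrable ?P (\<lambda>E. H {?w E} E)"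
      proof (rule P.integrable_const_bound[where B=B])
        have "?w E \<in> I" for E using w_mem Kb by blast
        then show "AE E in ?P. norm (H {?w E} E) \<le> B" using H_bound by simp
        show "(\<lambda>E. H {?w E} E) \<in> borel_measurable ?P"
        proof (rule measurable_compose_countable'[where g="?w" and f="\<lambda>i. H {i}"])
          show "?w \<in> measurable ?P (count_space (K b))"
            using w_set finK w_mem
            by (subst measurable_count_space_eq2) (auto simp: vimage_def Int_def conj_commute)
        qed (use Kb finK H_meas in \<open>auto intro: countable_finite\<close>)
      qed
      moreover have "race x E (K b) = {?w E}" for E using False by (simp add: race_def)
      ultimately have "(LINT E|?P. multilinear_extension (insert b Q) (\<lambda>T. f (\<Union>e\<in>T. race x E (K e))) ?s) =
          ?s b * (LINT E|?P. H {?w E} E) + (1 - ?s b) * (LINT E|?P. H {} E)"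
        unfolding expand using H_int[of "{}"] by simp
      also have "\<dots> = ?s b * (\<Sum>i\<in>K b. (x i / ?s b) * (LINT E|?P. H {i} E)) + (1 - ?s b) * (LINT E|?P. H {} E)"
        by (simp only: w_int)
      \<comment> \<open>The selection probability of the fibre cancels the normalization of its
        race: \<open>i\<close> is picked with total probability \<open>x i\<close>.\<close>
      also have "\<dots> = (\<Sum>i\<in>K b. x i * (LINT E|?P. H {i} E)) + (1 - ?s b) * (LINT E|?P. H {} E)"
        using spos by (simp add: sum_distrib_left)
      \<comment> \<open>The induction hypothesis is used for each \<open>V = {i}\<close> and for
        \<open>V = {}\<close>. The weight \<open>1 - ?s b\<close> of the latter is nonnegative
        because the fibre has weight at most 1.\<close>
      also have "\<dots> \<ge> (\<Sum>i\<in>K b. x i * multilinear_extension (\<Union>e\<in>Q. K e) (\<lambda>W. f ({i} \<union> W)) x)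
          + (1 - ?s b) * multilinear_extension (\<Union>e\<in>Q. K e) (\<lambda>W. f ({} \<union> W)) x"
        using insert.prems(3)[of b] Kb s[of b]
        by (intro add_mono sum_mono mult_left_mono IH) (auto simp: less_imp_le)
      also have "(\<Sum>i\<in>K b. x i * multilinear_extension (\<Union>e\<in>Q. K e) (\<lambda>W. f ({i} \<union> W)) x)
          + (1 - ?s b) * multilinear_extension (\<Union>e\<in>Q. K e) (\<lambda>W. f ({} \<union> W)) x =
          multilinear_extension (\<Union>e\<in>Q. K e) (\<lambda>W. (\<Sum>i\<in>K b. x i * f ({i} \<union> W)) + (1 - ?s b) * f ({} \<union> W)) x"
        by (simp only: multilinear_extension_add multilinear_extension_sum multilinear_extension_cmult)
      \<comment> \<open>For each fixed \<open>W\<close>, picking at most one element of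
        \<open>K b\<close> is replaced by rounding \<open>K b\<close> independently, which can only
        lower the value.\<close>
      also have "\<dots> \<ge> multilinear_extension (\<Union>e\<in>Q. K e) (\<lambda>W. multilinear_extension (K b) (\<lambda>U. f (U \<union> W)) x) x"
      proof -
        have x01: "x i \<in> {0..1}" if "e \<in> insert b Q" "i \<in> K e" for e i
        proof -
          have "x i \<le> sum x (K e)"
            using that finK insert.prems(3) by (intro member_le_sum) (auto simp: less_imp_le)
          then show ?thesis using s[OF that(1)] insert.prems(3)[OF that] by auto
        qed
        have "multilinear_extension (K b) (\<lambda>U. f (U \<union> W)) x \<le>
            (\<Sum>i\<in>K b. x i * f ({i} \<union> W)) + (1 - ?s b) * f ({} \<union> W)" if "W \<subseteq> (\<Union>e\<in>Q. K e)" for W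
        proof (rule multilinear_extension_le_linear)
          have "W \<subseteq> I" using that insert.prems(2) by blast
          then show "submodular_on (K b) (\<lambda>U. f (U \<union> W))"
            using submodular_on_subset[OF submodular_on_contract Kb] insert.prems(5) by blast
        qed (use finK x01 in auto)
        then show ?thesis using x01 by (intro multilinear_extension_mono) auto
      qed
      also have "multilinear_extension (\<Union>e\<in>Q. K e) (\<lambda>W. multilinear_extension (K b) (\<lambda>U. f (U \<union> W)) x) x =
          multilinear_extension (\<Union>e\<in>insert b Q. K e) f x"
        using insert.hyps(1) finK disj(2) by (simp add: multilinear_extension_union)
      finally show ?thesis .
    qed
  }
qed


section \<open>Marginals of tree pivotal sampling\<close>

abbreviation unif01 :: "real measure" where
  "unif01 \<equiv> uniform_measure lborel {0..1}"

lemma prob_space_unif01: "prob_space unif01"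
  by (rule prob_space_uniform_measure) auto

lemma measure_unif01_atMost:
  assumes "c \<in> {0..1}"
  shows "measure unif01 {..c} = c" "measure unif01 {..<c} = c"
proof -
  have "{0..1} \<inter> {..c} = {0..c}" "{0..1} \<inter> {..<c} = {0..<c}" using assms by auto
  then show "measure unif01 {..c} = c" "measure unif01 {..<c} = c"
    using assms by (simp_all add: measure_uniform_measure)
qed

lemma integral_unif01_threshold:
  assumes "c \<in> {0..1}"
  shows "(LINT u|unif01. (if u \<le> c then p else q)) = c * p + (1 - c) * (q :: real)"
proof -
  interpret prob_space unif01 by (rule prob_space_unif01)
  have "integrable unif01 (indicat_real {..c})"
    by (rule integrable_const_bound[where B=1]) (auto simp: indicator_def)
  moreover have "(LINT u|unif01. (if u \<le> c then p else q)) = (LINT u|unif01. q + (p - q) * indicator {..c} u)"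
    by (rule Bochner_Integration.integral_cong) (auto simp: indicator_def)
  ultimately have "(LINT u|unif01. (if u \<le> c then p else q)) = q + (p - q) * measure unif01 {..c}"
    using prob_space by (simp add: algebra_simps del: measure_uniform_measure)
  then have "(LINT u|unif01. (if u \<le> c then p else q)) = q + (p - q) * c"
    using assms by (simp only: measure_unif01_atMost)
  then show ?thesis by (simp add: algebra_simps)
qed

section \<open>A single pivot step\<close>

definition pivot_step :: "real \<Rightarrow> nat \<Rightarrow> nat \<Rightarrow> (nat \<Rightarrow> real) \<Rightarrow> nat \<times> (nat \<Rightarrow> real)" where
  "pivot_step u i j v =
    (if v i + v j \<le> 1
     then (if u \<le> v i / (v i + v j) then (i, v(i := v i + v j, j := 0)) else (j, v(i := 0, j := v i + v j)))
     else (if u \<le> (1 - v j) / (2 - v i - v j)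
           then (j, v(i := 1, j := v i + v j - 1)) else (i, v(i := v i + v j - 1, j := 1))))"

lemma pivot_Br:
  "pivot \<theta> (Br l r) v =
    (case pivot (\<lambda>q. \<theta> (False # q)) l v of (i, v1) \<Rightarrow>
     case pivot (\<lambda>q. \<theta> (True # q)) r v1 of (j, v2) \<Rightarrow> pivot_step (\<theta> []) i j v2)"
  by (simp add: pivot_step_def Let_def case_prod_beta)

declare pivot.simps(2) [simp del]

text \<open>The thresholds are chosen to make a step a martingale. With \<open>a = v i\<close> and
  \<open>b = v j\<close>, coordinate \<open>i\<close> has mean
  \<open>(a + b) * a / (a + b) = a\<close> in the first case. In the second it has mean
  \<open>(a + b - 1) + p * (2 - a - b) = a\<close> for \<open>p = (1 - b) / (2 - a - b)\<close>. As
  the sum \<open>a + b\<close> is preserved, \<open>j\<close> has mean \<open>b\<close>. Vanishing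
  denominators are treated apart, since then both outcomes equal \<open>v\<close>.\<close>

lemma pivot_step_mean:
  assumes "i \<noteq> j" "v i \<in> {0..1}" "v j \<in> {0..1}"
  shows "(LINT u|unif01. snd (pivot_step u i j v) k) = v k"
proof -
  interpret prob_space unif01 by (rule prob_space_unif01)
  have 1: "v i / (v i + v j) \<in> {0..1}" using assms by (auto simp: divide_le_eq_1)
  have 2: "(1 - v j) / (2 - v i - v j) \<in> {0..1}" if "\<not> v i + v j \<le> 1"
    using assms by (auto simp: divide_le_eq_1)
  have "(LINT u|unif01. snd (pivot_step u i j v) k) =
      (LINT u|unif01. (if v i + v j \<le> 1
        then (if u \<le> v i / (v i + v j) then (v(i := v i + v j, j := 0)) k else (v(i := 0, j := v i + v j)) k)
        else (if u \<le> (1 - v j) / (2 - v i - v j)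
          then (v(i := 1, j := v i + v j - 1)) k else (v(i := v i + v j - 1, j := 1)) k)))"
    by (rule Bochner_Integration.integral_cong) (auto simp: pivot_step_def)
  also have "\<dots> = v k"
  proof (cases "v i + v j \<le> 1")
    case True
    show ?thesis
    proof (cases "v i + v j = 0")
      case True
      then have "v i = 0" "v j = 0" using assms by auto
      then have "v(i := v i + v j, j := 0) = v" "v(i := 0, j := v i + v j) = v"
        by (auto simp: fun_eq_iff)
      then show ?thesis using True by (simp only: if_cancel) (simp add: prob_space)
    next
      case False
      then show ?thesis
        using True assms(1) by (simp only: if_True integral_unif01_threshold[OF 1])
          (auto simp: left_diff_distrib)
    qed
  next
    case False
    show ?thesis
    proof (cases "v i = 1 \<and> v j = 1")
      case True
      then have "v(i := 1, j := v i + v j - 1) = v" "v(i := v i + v j - 1, j := 1) = v"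
        by (auto simp: fun_eq_iff)
      then show ?thesis using False by (simp only: if_cancel) (simp add: prob_space)
    next
      case neq: False
      then have "2 - v i - v j \<noteq> 0" using assms by auto
      then show ?thesis
        using False assms(1) by (simp only: if_False integral_unif01_threshold[OF 2[OF False]])
          (auto simp: divide_simps, (simp add: algebra_simps)+)
    qed
  qed
  finally show ?thesis .
qed

text \<open>An integrability bound. The term \<open>\<bar>v k\<bar>\<close> covers an arbitrary
  \<open>k\<close> outside the two coordinates, whose entry is unchanged and not assumed to lie in
  the unit interval.\<close>

lemma pivot_step_abs_le:
  assumes "v i \<in> {0..1}" "v j \<in> {0..1}"
  shows "\<bar>snd (pivot_step u i j v) k\<bar> \<le> 1 + \<bar>v k\<bar>"
  using assms by (auto simp: pivot_step_def)

section \<open>Finitely many outcomes and invariants of the recursion\<close>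

lemma finite_range_pivot_step: "finite (range (\<lambda>u. pivot_step u i j v))"
proof (rule finite_subset)
  show "range (\<lambda>u. pivot_step u i j v) \<subseteq>
    {(i, v(i := v i + v j, j := 0)), (j, v(i := 0, j := v i + v j)),
     (j, v(i := 1, j := v i + v j - 1)), (i, v(i := v i + v j - 1, j := 1))}"
    by (auto simp: pivot_step_def)
qed simp

text \<open>For a fixed input there are only finitely many outcomes, so conditioning on the result
  of a subtree is a finite case distinction, both for integrals and for measurability.\<close>

lemma finite_range_pivot: "finite (range (\<lambda>\<theta>. pivot \<theta> t v))"
proof (induction t arbitrary: v)
  case (Br l r)
  have "range (\<lambda>\<theta>. pivot \<theta> (Br l r) v) \<subseteq>
      (\<Union>p\<in>range (\<lambda>\<theta>. pivot \<theta> l v). \<Union>p'\<in>range (\<lambda>\<theta>. pivot \<theta> r (snd p)).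
        range (\<lambda>u. pivot_step u (fst p) (fst p') (snd p')))"
  proof (rule image_subsetI)
    fix \<theta>
    let ?p = "pivot (\<lambda>q. \<theta> (False # q)) l v"
    let ?q = "pivot (\<lambda>q. \<theta> (True # q)) r (snd ?p)"
    have "pivot \<theta> (Br l r) v = pivot_step (\<theta> []) (fst ?p) (fst ?q) (snd ?q)"
      by (simp add: pivot_Br case_prod_beta)
    then show "pivot \<theta> (Br l r) v \<in> (\<Union>p\<in>range (\<lambda>\<theta>. pivot \<theta> l v).
        \<Union>p'\<in>range (\<lambda>\<theta>. pivot \<theta> r (snd p)). range (\<lambda>u. pivot_step u (fst p) (fst p') (snd p')))"
      by blast
  qed
  then show ?case
    by (rule finite_subset) (intro finite_UN_I Br.IH finite_range_pivot_step)
qed simp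

lemma finite_inner_nodes: "finite (inner_nodes t)"
  by (induction t) auto

lemma pivot_cong:
  assumes "\<And>q. q \<in> inner_nodes t \<Longrightarrow> \<theta> q = \<theta>' q"
  shows "pivot \<theta> t v = pivot \<theta>' t v"
  using assms
proof (induction t arbitrary: \<theta> \<theta>' v)
  case (Br l r)
  have "pivot (\<lambda>q. \<theta> (False # q)) l v = pivot (\<lambda>q. \<theta>' (False # q)) l v" for v
    by (rule Br.IH) (use Br.prems in auto)
  moreover have "pivot (\<lambda>q. \<theta> (True # q)) r v = pivot (\<lambda>q. \<theta>' (True # q)) r v" for v
    by (rule Br.IH) (use Br.prems in auto)
  ultimately show ?case using Br.prems by (simp add: pivot_Br)
qed simp

text \<open>The subtrees have disjoint leaves, so the right pass keeps the results of the left one;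
  the step at the node then fixes one of the two carried coordinates at 0 or 1. Only the coordinate
  passed up can stay fractional, which is what makes the single rounding at the root
  suffice.\<close>

lemma pivot_invariants:
  assumes "distinct (tree_leaves t)" "\<And>j. j \<in> set (tree_leaves t) \<Longrightarrow> v j \<in> {0..1}"
    and "pivot \<theta> t v = (i, w)"
  shows "i \<in> set (tree_leaves t) \<and> (\<forall>j. j \<notin> set (tree_leaves t) \<longrightarrow> w j = v j) \<and>
    (\<forall>j\<in>set (tree_leaves t). w j \<in> {0..1}) \<and> (\<forall>j\<in>set (tree_leaves t) - {i}. w j \<in> {0, 1})"
  using assms
proof (induction t arbitrary: \<theta> v i w)
  case (Br l r)
  obtain i1 v1 where l: "pivot (\<lambda>q. \<theta> (False # q)) l v = (i1, v1)" by fastforce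
  obtain i2 v2 where r: "pivot (\<lambda>q. \<theta> (True # q)) r v1 = (i2, v2)" by fastforce
  have disj: "set (tree_leaves l) \<inter> set (tree_leaves r) = {}" using Br.prems(1) by simp
  have L: "i1 \<in> set (tree_leaves l)" "\<And>j. j \<notin> set (tree_leaves l) \<Longrightarrow> v1 j = v j"
      "\<And>j. j \<in> set (tree_leaves l) \<Longrightarrow> v1 j \<in> {0..1}"
      "\<And>j. j \<in> set (tree_leaves l) - {i1} \<Longrightarrow> v1 j \<in> {0, 1}"
    using Br.IH(1)[OF _ _ l] Br.prems(1,2) by auto
  have "v1 j \<in> {0..1}" if "j \<in> set (tree_leaves r)" for j
  proof -
    have "j \<notin> set (tree_leaves l)" using disj that by blast
    then show ?thesis using L(2)[of j] Br.prems(2)[of j] that by simp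
  qed
  then have R: "i2 \<in> set (tree_leaves r)" "\<And>j. j \<notin> set (tree_leaves r) \<Longrightarrow> v2 j = v1 j"
      "\<And>j. j \<in> set (tree_leaves r) \<Longrightarrow> v2 j \<in> {0..1}"
      "\<And>j. j \<in> set (tree_leaves r) - {i2} \<Longrightarrow> v2 j \<in> {0, 1}"
    using Br.IH(2)[OF _ _ r] Br.prems(1) by auto
  have v2: "v2 j \<in> {0..1}" if "j \<in> set (tree_leaves (Br l r))" for j
    using that R(2)[of j] R(3)[of j] L(3)[of j] by (cases "j \<in> set (tree_leaves r)") auto
  have v2': "v2 j = 0 \<or> v2 j = 1" if "j \<in> set (tree_leaves (Br l r)) - {i1, i2}" for j
    using that R(2)[of j] R(4)[of j] L(4)[of j] by (cases "j \<in> set (tree_leaves r)") auto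
  have v2'': "v2 j = v j" if "j \<notin> set (tree_leaves (Br l r))" for j
    using that R(2)[of j] L(2)[of j] by auto
  have step: "(i, w) = pivot_step (\<theta> []) i1 i2 v2"
    using Br.prems(3) by (simp add: pivot_Br l r)
  have ne: "i1 \<noteq> i2" using L(1) R(1) disj by auto
  have i12: "i1 \<in> set (tree_leaves (Br l r))" "i2 \<in> set (tree_leaves (Br l r))"
    using L(1) R(1) by auto
  have "v2 i1 \<in> {0..1}" "v2 i2 \<in> {0..1}" using v2 i12 by auto
  then have w: "i \<in> {i1, i2}" "\<And>j. j \<notin> {i1, i2} \<Longrightarrow> w j = v2 j"
      "\<And>j. j \<in> {i1, i2} \<Longrightarrow> w j \<in> {0..1}" "\<And>j. j \<in> {i1, i2} - {i} \<Longrightarrow> w j = 0 \<or> w j = 1"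
    using step ne by (auto simp: pivot_step_def split: if_splits)
  show ?case
  proof (intro conjI allI ballI impI)
    show "i \<in> set (tree_leaves (Br l r))" using w(1) i12 by blast
    fix j
    show "w j = v j" if "j \<notin> set (tree_leaves (Br l r))"
    proof -
      have "j \<notin> {i1, i2}" using that i12 by blast
      then show ?thesis using w(2)[of j] v2''[OF that] by simp
    qed
    show "w j \<in> {0..1}" if "j \<in> set (tree_leaves (Br l r))"
      using w(2,3)[of j] v2[OF that] by (cases "j \<in> {i1, i2}") auto
    show "w j \<in> {0, 1}" if "j \<in> set (tree_leaves (Br l r)) - {i}"
      using w(2,4)[of j] v2'[of j] that by (cases "j \<in> {i1, i2}") auto
  qed
qed auto

lemma pivot_abs_le:
  assumes "distinct (tree_leaves t)" "\<And>j. j \<in> set (tree_leaves t) \<Longrightarrow> v j \<in> {0..1}"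
  shows "\<bar>snd (pivot \<theta> t v) k\<bar> \<le> 1 + \<bar>v k\<bar>"
proof -
  obtain i w where p: "pivot \<theta> t v = (i, w)" by fastforce
  from pivot_invariants[OF assms p] show ?thesis
    by (cases "k \<in> set (tree_leaves t)") (auto simp: p)
qed

lemma measurable_compose_finite_range:
  assumes "finite (range g)" "g \<in> measurable M (count_space UNIV)"
    and "\<And>r. r \<in> range g \<Longrightarrow> f r \<in> measurable M N"
  shows "(\<lambda>\<omega>. f (g \<omega>) \<omega>) \<in> measurable M N"
proof (rule measurable_compose_countable'[where g=g and I="range g"])
  show "g \<in> measurable M (count_space (range g))"
  proof (subst measurable_count_space_eq2[OF assms(1)], safe)
    fix r show "g -` {r} \<inter> space M \<in> sets M"
      using assms(2) by (auto intro: measurable_sets)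
  qed auto
qed (use assms in \<open>auto intro: countable_finite\<close>)

lemma measurable_pivot_step: "(\<lambda>u. pivot_step u i j v) \<in> measurable unif01 (count_space UNIV)"
  unfolding pivot_step_def by measurable

text \<open>Subtrees are addressed by prefixes of paths, so that all levels of the recursion live on the
  same product space.\<close>
lemma measurable_pivot:
  assumes "(@) pre ` inner_nodes t \<subseteq> J"
  shows "(\<lambda>\<theta>. pivot (\<lambda>q. \<theta> (pre @ q)) t v) \<in> measurable (PiM J (\<lambda>_. unif01)) (count_space UNIV)"
  using assms
proof (induction t arbitrary: pre v)
  case (Br l r)
  let ?P = "PiM J (\<lambda>_. unif01)"
  have sub: "(@) (pre @ [False]) ` inner_nodes l \<subseteq> J" "(@) (pre @ [True]) ` inner_nodes r \<subseteq> J" "pre \<in> J"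
    using Br.prems by (auto simp: image_subset_iff)
  have step: "(\<lambda>\<theta>. pivot_step (\<theta> pre) i j w) \<in> measurable ?P (count_space UNIV)" for i j w
    using measurable_component_singleton[OF sub(3)] measurable_pivot_step by (rule measurable_compose)
  have fin: "finite (range (\<lambda>\<theta>. pivot (\<lambda>q. \<theta> (pre @ q)) t w))" for t pre w
    by (rule finite_subset[OF _ finite_range_pivot[of t w]]) auto
  have r: "(\<lambda>\<theta>. case pivot (\<lambda>q. \<theta> ((pre @ [True]) @ q)) r w of (j, v2) \<Rightarrow> pivot_step (\<theta> pre) i j v2)
      \<in> measurable ?P (count_space UNIV)" for i w
    by (rule measurable_compose_finite_range[OF fin Br.IH(2)[OF sub(2)],
          where f="\<lambda>p \<theta>. case p of (j, v2) \<Rightarrow> pivot_step (\<theta> pre) i j v2"])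
      (auto simp: step split: prod.splits)
  have "(\<lambda>\<theta>. case pivot (\<lambda>q. \<theta> ((pre @ [False]) @ q)) l v of (i, v1) \<Rightarrow>
      case pivot (\<lambda>q. \<theta> ((pre @ [True]) @ q)) r v1 of (j, v2) \<Rightarrow> pivot_step (\<theta> pre) i j v2)
      \<in> measurable ?P (count_space UNIV)"
    by (rule measurable_compose_finite_range[OF fin Br.IH(1)[OF sub(1)],
          where f="\<lambda>p \<theta>. case p of (i, v1) \<Rightarrow> case pivot (\<lambda>q. \<theta> ((pre @ [True]) @ q)) r v1 of
            (j, v2) \<Rightarrow> pivot_step (\<theta> pre) i j v2"])
      (use r in \<open>auto split: prod.splits\<close>)
  then show ?case by (simp add: pivot_Br)
qed simp

text \<open>A martingale argument along the tree: condition on the result of the left subtree, then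
  on that of the right one, so that only the uniform variable of the node remains and
  \<open>pivot_step_mean\<close> applies. Undoing the conditioning uses the induction hypotheses for
  the two subtrees.\<close>

lemma pivot_mean:
  assumes "finite J" "(@) pre ` inner_nodes t \<subseteq> J" "distinct (tree_leaves t)"
    and "\<And>j. j \<in> set (tree_leaves t) \<Longrightarrow> v j \<in> {0..1}"
  shows "(LINT \<theta>|PiM J (\<lambda>_. unif01). snd (pivot (\<lambda>q. \<theta> (pre @ q)) t v) k) = v k"
  using assms(2-)
proof (induction t arbitrary: pre v)
  interpret product_prob_space "\<lambda>_. unif01" J
    by (intro product_prob_spaceI prob_space_unif01)
  let ?P = "PiM J (\<lambda>_. unif01)"
  interpret P: prob_space ?P by (intro prob_space_PiM prob_space)
  {
    case (Lf i)
    then show ?case by (simp add: P.prob_space)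
  next
    case (Br l r)
    let ?l = "\<lambda>\<theta>. pivot (\<lambda>q. \<theta> ((pre @ [False]) @ q)) l v"
    let ?r = "\<lambda>v1 \<theta>. pivot (\<lambda>q. \<theta> ((pre @ [True]) @ q)) r v1"
    let ?JL = "(@) (pre @ [False]) ` inner_nodes l" and ?JR = "(@) (pre @ [True]) ` inner_nodes r"
    have sub: "?JL \<subseteq> J" "?JR \<subseteq> J" "pre \<in> J"
      using Br.prems by (auto simp: image_subset_iff)
    \<comment> \<open>Addresses inside the subtrees are strictly longer than \<open>pre\<close>, so
      the variable of this node is independent of both recursive results.\<close>
    have pre: "pre \<notin> ?JL" "pre \<notin> ?JR" by (auto dest: arg_cong[where f=length])
    have disj: "set (tree_leaves l) \<inter> set (tree_leaves r) = {}"
      and dist: "distinct (tree_leaves l)" "distinct (tree_leaves r)" using Br.prems(2) by simp_all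
    have vl: "v j \<in> {0..1}" if "j \<in> set (tree_leaves l)" for j using that Br.prems(3) by simp
    have coord: "(\<lambda>\<theta>. \<theta> pre) \<in> measurable ?P unif01"
      using sub(3) by (rule measurable_component_singleton)
    have step_int: "(LINT \<theta>|?P. h (\<theta> pre)) = (LINT u|unif01. h u)" if "h \<in> borel_measurable unif01"
      for h :: "real \<Rightarrow> real"
      using integral_distr[OF coord that] PiM_component[OF sub(3)] by simp
    have step_meas: "(\<lambda>u. snd (pivot_step u i j w) k) \<in> borel_measurable unif01" for i j w
      using measurable_pivot_step by (rule measurable_compose) simp
    have sets_eq: "{\<theta> \<in> space ?P. pivot (\<lambda>q. \<theta> (pre' @ q)) t w = p} \<in> sets ?P"
      if "(@) pre' ` inner_nodes t \<subseteq> J" for pre' t w p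
      using measurable_pivot[OF that, of w] by measurable
    have step_coord: "(\<lambda>\<theta>. snd (pivot_step (\<theta> pre) i j w) k) \<in> borel_measurable ?P" for i j w
      using coord step_meas by (rule measurable_compose)
    have r_dep: "?r v1 \<theta> = ?r v1 \<theta>'" if "\<And>q. q \<in> ?JR \<Longrightarrow> \<theta> q = \<theta>' q" for v1 \<theta> \<theta>'
      by (rule pivot_cong) (use that in auto)
    have l_dep: "?l \<theta> = ?l \<theta>'" if "\<And>q. q \<in> ?JL \<Longrightarrow> \<theta> q = \<theta>' q" for \<theta> \<theta>'
      by (rule pivot_cong) (use that in auto)
    let ?F = "\<lambda>p \<theta>. snd (pivot_step (\<theta> pre) (fst p) (fst (?r (snd p) \<theta>)) (snd (?r (snd p) \<theta>))) k"
    \<comment> \<open>The left result \<open>p\<close> is frozen here. Its vector is the input of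
      the right pass, whose mean is \<open>snd p k\<close> by the induction hypothesis, and the step
      at the node keeps that mean. The bound gains 1 from the right pass and 1 from the
      step.\<close>
    have inner: "(LINT \<theta>|?P. ?F p \<theta>) = snd p k" and inner_meas: "?F p \<in> borel_measurable ?P"
      and inner_le: "\<And>\<theta>. \<bar>?F p \<theta>\<bar> \<le> 2 + \<bar>snd p k\<bar>"
      if i: "fst p \<in> set (tree_leaves l)" "snd p (fst p) \<in> {0..1}"
        and v1: "\<And>j. j \<in> set (tree_leaves r) \<Longrightarrow> snd p j \<in> {0..1}" for p
    proof -
      have inv: "fst (pivot \<theta> r (snd p)) \<in> set (tree_leaves r)"
          "snd (pivot \<theta> r (snd p)) (fst p) = snd p (fst p)"
          "snd (pivot \<theta> r (snd p)) (fst (pivot \<theta> r (snd p))) \<in> {0..1}" for \<theta>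
        using pivot_invariants[where v="snd p" and \<theta>=\<theta> and i="fst (pivot \<theta> r (snd p))"
            and w="snd (pivot \<theta> r (snd p))", OF dist(2) v1] disj i(1)
        by auto
      show "?F p \<in> borel_measurable ?P"
        by (rule measurable_compose_finite_range[OF _ measurable_pivot[OF sub(2), of "snd p"],
              where f="\<lambda>p' \<theta>. snd (pivot_step (\<theta> pre) (fst p) (fst p') (snd p')) k"])
          (auto intro: step_coord finite_subset[OF _ finite_range_pivot])
      show "\<bar>?F p \<theta>\<bar> \<le> 2 + \<bar>snd p k\<bar>" for \<theta>
      proof -
        have "\<bar>?F p \<theta>\<bar> \<le> 1 + \<bar>snd (?r (snd p) \<theta>) k\<bar>"
          using inv i(2) by (intro pivot_step_abs_le) auto
        moreover have "\<bar>snd (?r (snd p) \<theta>) k\<bar> \<le> 1 + \<bar>snd p k\<bar>"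
          by (rule pivot_abs_le[where v="snd p", OF dist(2) v1])
        ultimately show ?thesis by simp
      qed
      have "(LINT \<theta>|?P. ?F p \<theta>) = (LINT \<theta>|?P. snd (?r (snd p) \<theta>) k)"
      proof (rule integral_PiM_condition[where J="?JR" and g="?r (snd p)" and h="\<lambda>p'. snd p' k"
            and R="range (\<lambda>\<theta>. pivot \<theta> r (snd p))" and B="\<lambda>p'. 1 + \<bar>snd p' k\<bar>"
            and F="\<lambda>p' \<theta>. snd (pivot_step (\<theta> pre) (fst p) (fst p') (snd p')) k"])
        fix p' assume "p' \<in> range (\<lambda>\<theta>. pivot \<theta> r (snd p))"
        then obtain \<theta>' where p': "p' = pivot \<theta>' r (snd p)" by auto
        have *: "fst p \<noteq> fst p'" "snd p' (fst p) \<in> {0..1}" "snd p' (fst p') \<in> {0..1}"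
          using inv[of \<theta>'] i disj unfolding p' by auto
        show "(LINT \<theta>|?P. snd (pivot_step (\<theta> pre) (fst p) (fst p') (snd p')) k) = snd p' k"
          using step_int[OF step_meas] pivot_step_mean[OF *] by simp
        show "\<bar>snd (pivot_step (\<theta> pre) (fst p) (fst p') (snd p')) k\<bar> \<le> 1 + \<bar>snd p' k\<bar>" for \<theta>
          using * by (intro pivot_step_abs_le) auto
        show "snd (pivot_step (\<theta> pre) (fst p) (fst p') (snd p')) k =
            snd (pivot_step (\<theta>' pre) (fst p) (fst p') (snd p')) k"
          if "\<And>q. q \<in> J - ?JR \<Longrightarrow> \<theta> q = \<theta>' q" for \<theta> \<theta>'
          using that[of pre] sub(3) pre by simp
      next
        show "?r (snd p) \<theta> = ?r (snd p) \<theta>'" if "\<And>q. q \<in> ?JR \<Longrightarrow> \<theta> q = \<theta>' q" for \<theta> \<theta>'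
          using that by (rule r_dep)
      qed (rule assms(1) sub(2) sets_eq[OF sub(2)] finite_range_pivot step_coord rangeI)+
      also have "\<dots> = snd p k" using Br.IH(2)[OF sub(2) dist(2) v1] .
      finally show "(LINT \<theta>|?P. ?F p \<theta>) = snd p k" .
    qed
    \<comment> \<open>Now the left result varies: it depends on \<open>?JL\<close>, while for frozen
      \<open>p\<close> the function \<open>?F p\<close> depends on the right subtree and the node
      itself.\<close>
    have "(LINT \<theta>|?P. ?F (?l \<theta>) \<theta>) = (LINT \<theta>|?P. snd (?l \<theta>) k)"
    proof (rule integral_PiM_condition[where J="?JL" and g="?l" and h="\<lambda>p. snd p k"
          and R="range (\<lambda>\<theta>. pivot \<theta> l v)" and B="\<lambda>p. 2 + \<bar>snd p k\<bar>" and F="?F"])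
      fix p assume "p \<in> range (\<lambda>\<theta>. pivot \<theta> l v)"
      then obtain \<theta>' where "pivot \<theta>' l v = (fst p, snd p)" by auto
      from pivot_invariants[OF dist(1) vl this]
      have *: "fst p \<in> set (tree_leaves l)" "snd p (fst p) \<in> {0..1}"
        "\<And>j. j \<in> set (tree_leaves r) \<Longrightarrow> snd p j \<in> {0..1}"
        using disj Br.prems(3) by auto
      show "(LINT \<theta>|?P. ?F p \<theta>) = snd p k" by (rule inner[OF *])
      show "?F p \<in> borel_measurable ?P" by (rule inner_meas[OF *])
      show "\<bar>?F p \<theta>\<bar> \<le> 2 + \<bar>snd p k\<bar>" for \<theta> by (rule inner_le[OF *])
    next
      show "?l \<theta> = ?l \<theta>'" if "\<And>q. q \<in> ?JL \<Longrightarrow> \<theta> q = \<theta>' q" for \<theta> \<theta>'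
        using that by (rule l_dep)
    next
      fix p :: "nat \<times> (nat \<Rightarrow> real)" and \<theta> \<theta>' :: "bool list \<Rightarrow> real" assume eq: "\<And>q. q \<in> J - ?JL \<Longrightarrow> \<theta> q = \<theta>' q"
      have "?r (snd p) \<theta> = ?r (snd p) \<theta>'"
        by (rule r_dep, rule eq) (use sub(2) in auto)
      moreover have "\<theta> pre = \<theta>' pre" by (rule eq) (use sub(3) pre in auto)
      ultimately show "?F p \<theta> = ?F p \<theta>'" by simp
    qed (rule assms(1) sub(1) sets_eq[OF sub(1)] finite_range_pivot rangeI)+
    also have "\<dots> = v k" by (rule Br.IH(1)[OF sub(1) dist(1) vl])
    finally show ?case by (simp add: pivot_Br case_prod_beta)
  }
qed

section \<open>The random set returned at the root\<close>

lemma tree_pivotal_eq: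
  "tree_pivotal t \<omega> z =
    {j \<in> set (tree_leaves t). (case pivot (fst \<omega>) t z of (i, v) \<Rightarrow> if j = i then snd \<omega> < v i else v j = 1)}"
  by (auto simp: tree_pivotal_def case_prod_beta Let_def split: if_splits)

lemma tree_pivotal_subset: "tree_pivotal t \<omega> z \<subseteq> set (tree_leaves t)"
  unfolding tree_pivotal_eq by blast

lemma sets_mem_tree_pivotal: "{\<omega> \<in> space (pivot_space t). j \<in> tree_pivotal t \<omega> z} \<in> sets (pivot_space t)"
proof -
  let ?f = "\<lambda>p \<omega>. case p of (i, v) \<Rightarrow> if j = i then snd \<omega> < v i else v j = (1 :: real)"
  have "(\<lambda>\<theta>. pivot \<theta> t z) \<in> measurable (PiM (inner_nodes t) (\<lambda>_. unif01)) (count_space UNIV)"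
    using measurable_pivot[of "[]" t "inner_nodes t" z] by simp
  then have "(\<lambda>\<omega>. pivot (fst \<omega>) t z) \<in> measurable (pivot_space t) (count_space UNIV)"
    unfolding pivot_space_def by measurable
  moreover have "?f p \<in> measurable (pivot_space t) (count_space UNIV)" for p
    unfolding pivot_space_def by (cases p; cases "j = fst p"; simp; measurable)
  moreover have "finite (range (\<lambda>\<omega> :: (bool list \<Rightarrow> real) \<times> real. pivot (fst \<omega>) t z))"
    by (rule finite_subset[OF _ finite_range_pivot[of t z]]) auto
  ultimately have "(\<lambda>\<omega>. ?f (pivot (fst \<omega>) t z) \<omega>) \<in> measurable (pivot_space t) (count_space UNIV)"
    by (rule measurable_compose_finite_range[where f="?f" and g="\<lambda>\<omega>. pivot (fst \<omega>) t z", rotated])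
  then have "{\<omega> \<in> space (pivot_space t). ?f (pivot (fst \<omega>) t z) \<omega>} \<in> sets (pivot_space t)"
    by measurable
  then show ?thesis
    by (cases "j \<in> set (tree_leaves t)") (simp_all add: tree_pivotal_eq)
qed

lemma prob_space_pivot_space: "prob_space (pivot_space t)"
proof -
  interpret A: prob_space "PiM (inner_nodes t) (\<lambda>_. unif01)" by (intro prob_space_PiM prob_space_unif01)
  interpret B: prob_space unif01 by (rule prob_space_unif01)
  interpret pair_prob_space "PiM (inner_nodes t) (\<lambda>_. unif01)" unif01 ..
  show ?thesis unfolding pivot_space_def by (rule prob_space_axioms)
qed

text \<open>Dominance of pivotal sampling refers to the marginals of its output; this identifies
  them with the input vector. For fixed node variables the root rounds the last coordinate without
  bias, and \<open>pivot_mean\<close> averages over the node variables.\<close>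

lemma tree_pivotal_marginal:
  assumes "distinct (tree_leaves t)" "\<And>j. j \<in> set (tree_leaves t) \<Longrightarrow> z j \<in> {0..1}" "j \<in> set (tree_leaves t)"
  shows "(LINT \<omega>|pivot_space t. indicator (tree_pivotal t \<omega> z) j) = z j"
proof -
  let ?N = "PiM (inner_nodes t) (\<lambda>_. unif01)"
  interpret A: prob_space ?N by (intro prob_space_PiM prob_space_unif01)
  interpret B: prob_space unif01 by (rule prob_space_unif01)
  interpret AB: pair_prob_space ?N unif01 ..
  interpret P: prob_space "pivot_space t" by (rule prob_space_pivot_space)
  let ?S = "{\<omega> \<in> space (pivot_space t). j \<in> tree_pivotal t \<omega> z}"
  have "(LINT \<omega>|pivot_space t. indicator (tree_pivotal t \<omega> z) j) = (LINT \<omega>|pivot_space t. indicator ?S \<omega> :: real)"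
    by (rule Bochner_Integration.integral_cong) (auto simp: indicator_def)
  also have "\<dots> = (LINT \<theta>|?N. LINT u|unif01. indicator ?S (\<theta>, u))"
    using sets_mem_tree_pivotal[of t j z] unfolding pivot_space_def
    by (intro AB.integral_fst'[symmetric] AB.P.integrable_const_bound[where B=1]) auto
  also have "\<dots> = (LINT \<theta>|?N. snd (pivot \<theta> t z) j)"
  proof (rule Bochner_Integration.integral_cong[OF refl])
    fix \<theta> assume \<theta>: "\<theta> \<in> space ?N"
    obtain i v where p: "pivot \<theta> t z = (i, v)" by fastforce
    note inv = pivot_invariants[OF assms(1,2) p]
    \<comment> \<open>A fixed coordinate has value 0 or 1 and is thus its own membership indicator;
      only the coordinate carried to the root depends on \<open>u\<close>.\<close>
    have "indicator ?S (\<theta>, u) = (if j = i then indicator {..<v i} u else v j :: real)" for u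
      using inv assms(3) \<theta> by (auto simp: tree_pivotal_eq p indicator_def pivot_space_def space_pair_measure)
    then have "(LINT u|unif01. indicator ?S (\<theta>, u)) = (LINT u|unif01. (if j = i then indicator {..<v i} u else v j))"
      by simp
    also have "\<dots> = v j"
      using inv assms(3) measure_unif01_atMost(2)[of "v i"] by (cases "j = i") (auto simp: B.prob_space)
    finally show "(LINT u|unif01. indicator ?S (\<theta>, u)) = snd (pivot \<theta> t z) j" by (simp add: p)
  qed
  also have "\<dots> = z j"
    using pivot_mean[OF finite_inner_nodes, of "[]" t t z j] assms by simp
  finally show ?thesis .
qed


section \<open>The main branch for fixed hash values\<close>

definition alg_small :: "nat \<Rightarrow> (nat \<Rightarrow> real) \<Rightarrow> real \<Rightarrow> nat set" where
  "alg_small n x \<sigma> = {i \<in> {1..n}. 0 < x i \<and> x i \<le> 1/10 + \<sigma>}"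

definition alg_large :: "nat \<Rightarrow> (nat \<Rightarrow> real) \<Rightarrow> real \<Rightarrow> nat set" where
  "alg_large n x \<sigma> = {i \<in> {1..n}. x i > 1/10 + \<sigma>}"

definition alg_bucket :: "nat \<Rightarrow> (nat \<Rightarrow> nat) \<Rightarrow> nat \<Rightarrow> nat set" where
  "alg_bucket n \<beta> b = {i \<in> {1..n}. \<beta> i = b}"

text \<open>Here and in the definitions below, the sets \<open>S\<close> and \<open>L\<close> are
  parameters in place of \<open>\<sigma>\<close>. They take finitely many values, so measurability
  reduces to fixed \<open>S\<close> and \<open>L\<close>.\<close>

definition alg_fallback ::
    "nat \<Rightarrow> nat \<Rightarrow> (nat \<Rightarrow> real) \<Rightarrow> nat set \<Rightarrow> nat set \<Rightarrow> (nat \<Rightarrow> nat) \<Rightarrow> (nat \<Rightarrow> nat) \<Rightarrow> (nat \<Rightarrow> nat) \<Rightarrow> real \<Rightarrow> bool" where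
  "alg_fallback n m x S L R C \<beta> \<tau> \<longleftrightarrow>
     \<not> inj_on (case_sum C R) (L <+> {1..m}) \<or>
     (\<exists>b\<in>{1..m}. sum x (S \<inter> alg_bucket n \<beta> b) > 1 - \<tau>)"

definition alg_xhat ::
    "nat \<Rightarrow> nat \<Rightarrow> nat \<Rightarrow> (nat \<Rightarrow> real) \<Rightarrow> nat set \<Rightarrow> nat set \<Rightarrow> (nat \<Rightarrow> nat) \<Rightarrow> (nat \<Rightarrow> nat) \<Rightarrow> (nat \<Rightarrow> nat) \<Rightarrow> nat \<Rightarrow> real" where
  "alg_xhat n m d x S L R C \<beta> = (\<lambda>j\<in>{1..d}.
     if j \<in> R ` {1..m} then sum x (S \<inter> alg_bucket n \<beta> (inv_into {1..m} R j))
     else if j \<in> C ` L then x (inv_into L C j)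
     else 0)"

definition alg_rep :: "nat \<Rightarrow> (nat \<Rightarrow> real) \<Rightarrow> nat set \<Rightarrow> (nat \<Rightarrow> nat) \<Rightarrow> (nat \<Rightarrow> real) \<Rightarrow> nat \<Rightarrow> nat set" where
  "alg_rep n x S \<beta> E b = A1 n E
     (\<lambda>i. if i \<in> S \<inter> alg_bucket n \<beta> b then x i / sum x (S \<inter> alg_bucket n \<beta> b) else 0)"

definition alg_main ::
    "nat \<Rightarrow> nat \<Rightarrow> (nat \<Rightarrow> real) \<Rightarrow> nat set \<Rightarrow> nat set \<Rightarrow> (nat \<Rightarrow> nat) \<Rightarrow> (nat \<Rightarrow> nat) \<Rightarrow> (nat \<Rightarrow> nat) \<Rightarrow> (nat \<Rightarrow> real) \<Rightarrow> nat set \<Rightarrow> nat set" where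
  "alg_main n m x S L R C \<beta> E T = {i \<in> L. C i \<in> T} \<union>
     (\<Union>b\<in>{b \<in> {1..m}. sum x (S \<inter> alg_bucket n \<beta> b) > 0 \<and> R b \<in> T}. alg_rep n x S \<beta> E b)"

lemma ALG_eq:
  "ALG n k \<alpha> A t (\<omega>, E, \<theta>, R, C, \<beta>, \<sigma>, \<tau>) x =
    (let m = num_buckets k \<alpha>; S = alg_small n x \<sigma>; L = alg_large n x \<sigma>
     in if alg_fallback n m x S L R C \<beta> \<tau> then A \<omega> x
        else alg_main n m x S L R C \<beta> E
          (tree_pivotal t \<theta> (alg_xhat n m (hash_dim k \<alpha>) x S L R C \<beta>)))"
proof -
  have if_or: "(if a then u else if b then u else v) = (if a \<or> b then u else v)" for a b and u v :: "nat set"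
    by simp
  show ?thesis
    unfolding ALG_def alg_fallback_def alg_main_def alg_rep_def alg_xhat_def alg_small_def
      alg_large_def alg_bucket_def Let_def prod.case
    by (rule if_or)
qed

text \<open>Every positive element is sent to the coordinate that carries its weight: its own
  \<open>C i\<close> if it is large, the one of its bucket otherwise. Large elements and buckets
  thereby form one family.\<close>

definition alg_fibre ::
    "nat \<Rightarrow> (nat \<Rightarrow> real) \<Rightarrow> real \<Rightarrow> (nat \<Rightarrow> nat) \<Rightarrow> (nat \<Rightarrow> nat) \<Rightarrow> (nat \<Rightarrow> nat) \<Rightarrow> nat \<Rightarrow> nat set" where
  "alg_fibre n x \<sigma> R C \<beta> e =
     {i \<in> {1..n}. 0 < x i \<and> (if x i > 1/10 + \<sigma> then C i else R (\<beta> i)) = e}"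

text \<open>A fixed outcome of the hash variables outside the fallback case. The threshold
  \<open>\<tau>\<close> has been absorbed: \<open>bucket_le\<close> keeps only the bound 1 that
  follows from \<open>1 - \<tau>\<close>.\<close>

locale hashed_input =
  fixes n m d :: nat and x :: "nat \<Rightarrow> real" and \<sigma> :: real and R C \<beta> :: "nat \<Rightarrow> nat"
  assumes x: "\<And>i. i \<in> {1..n} \<Longrightarrow> x i \<in> {0..1}"
    and \<sigma>: "0 \<le> \<sigma>"
    and R: "\<And>b. b \<in> {1..m} \<Longrightarrow> R b \<in> {1..d}"
    and C: "\<And>i. i \<in> {1..n} \<Longrightarrow> C i \<in> {1..d}"
    and \<beta>: "\<And>i. i \<in> {1..n} \<Longrightarrow> \<beta> i \<in> {1..m}"
    and inj: "inj_on (case_sum C R) (alg_large n x \<sigma> <+> {1..m})"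
    and bucket_le: "\<And>b. b \<in> {1..m} \<Longrightarrow> sum x (alg_small n x \<sigma> \<inter> alg_bucket n \<beta> b) \<le> 1"
begin

abbreviation "S \<equiv> alg_small n x \<sigma>"
abbreviation "L \<equiv> alg_large n x \<sigma>"
abbreviation "K \<equiv> alg_fibre n x \<sigma> R C \<beta>"
abbreviation "xhat \<equiv> alg_xhat n m d x S L R C \<beta>"

lemma inj_R: "inj_on R {1..m}"
proof (rule inj_onI)
  fix a b assume "a \<in> {1..m}" "b \<in> {1..m}" "R a = R b"
  then show "a = b" using inj_onD[OF inj, of "Inr a" "Inr b"] by (simp add: InrI)
qed

lemma inj_C: "inj_on C L"
proof (rule inj_onI)
  fix i j assume "i \<in> L" "j \<in> L" "C i = C j"
  then show "i = j" using inj_onD[OF inj, of "Inl i" "Inl j"] by (simp add: InlI)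
qed

lemma C_neq_R: "i \<in> L \<Longrightarrow> b \<in> {1..m} \<Longrightarrow> C i \<noteq> R b"
  using inj by (auto dest: inj_onD[of _ _ "Inl i" "Inr b"])

text \<open>Without collisions no large element and no other bucket is hashed to
  \<open>R b\<close>.\<close>

lemma fibre_R:
  assumes b: "b \<in> {1..m}"
  shows "K (R b) = S \<inter> alg_bucket n \<beta> b"
proof (intro set_eqI iffI)
  fix i assume i: "i \<in> K (R b)"
  then have "i \<notin> L" using C_neq_R[OF _ b, of i] by (auto simp: alg_fibre_def alg_large_def)
  then have S: "i \<in> S" and "R (\<beta> i) = R b" and "i \<in> {1..n}"
    using i by (auto simp: alg_fibre_def alg_large_def alg_small_def split: if_splits)
  then have "\<beta> i = b" using inj_onD[OF inj_R] \<beta> b by blast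
  with S show "i \<in> S \<inter> alg_bucket n \<beta> b" by (auto simp: alg_bucket_def alg_small_def)
qed (auto simp: alg_fibre_def alg_small_def alg_bucket_def)

lemma fibre_C:
  assumes i: "i \<in> L"
  shows "K (C i) = {i}"
proof (intro set_eqI iffI)
  fix j assume j: "j \<in> K (C i)"
  have "j \<in> L"
  proof (rule ccontr)
    assume "j \<notin> L"
    then have "R (\<beta> j) = C i" "j \<in> {1..n}"
      using j by (auto simp: alg_fibre_def alg_large_def split: if_splits)
    then show False using C_neq_R[OF i \<beta>] by metis
  qed
  then have "C j = C i" using j by (auto simp: alg_fibre_def alg_large_def)
  then show "j \<in> {i}" using inj_onD[OF inj_C _ \<open>j \<in> L\<close> i] by simp
qed (use i \<sigma> in \<open>auto simp: alg_fibre_def alg_large_def\<close>)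

lemma fibre_empty:
  assumes "e \<notin> R ` {1..m}" "e \<notin> C ` L"
  shows "K e = {}"
  using assms \<beta> by (auto simp: alg_fibre_def alg_large_def)

lemma finite_fibre: "finite (K e)"
  by (simp add: alg_fibre_def)

lemma fibre_subset: "K e \<subseteq> {1..n}"
  by (auto simp: alg_fibre_def)

lemma fibre_pos: "i \<in> K e \<Longrightarrow> 0 < x i"
  by (simp add: alg_fibre_def)

lemma disjoint_fibre: "disjoint_family_on K Q"
  by (auto simp: disjoint_family_on_def alg_fibre_def)

lemma Union_fibre: "(\<Union>e\<in>{1..d}. K e) = {i \<in> {1..n}. 0 < x i}"
proof (intro set_eqI iffI)
  fix i assume i: "i \<in> {i \<in> {1..n}. 0 < x i}"
  then have "(if x i > 1/10 + \<sigma> then C i else R (\<beta> i)) \<in> {1..d}" using R C \<beta> by simp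
  with i show "i \<in> (\<Union>e\<in>{1..d}. K e)" unfolding alg_fibre_def by blast
qed (auto simp: alg_fibre_def)

lemma fibre_cases:
  obtains b where "b \<in> {1..m}" "e = R b" | i where "i \<in> L" "e = C i"
  | "e \<notin> R ` {1..m}" "e \<notin> C ` L"
  by blast

lemma sum_fibre: "sum x (K e) \<in> {0..1}"
proof -
  have "0 \<le> sum x (K e)" using fibre_pos by (intro sum_nonneg) (auto intro: less_imp_le)
  moreover have "sum x (K e) \<le> 1"
  proof (cases e rule: fibre_cases)
    case (1 b)
    then show ?thesis using bucket_le by (simp add: fibre_R)
  next
    case (2 i)
    then show ?thesis using x[of i] by (simp add: fibre_C alg_large_def)
  next
    case 3
    then show ?thesis by (simp add: fibre_empty)
  qed
  ultimately show ?thesis by simp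
qed

text \<open>The hashed vector is the push-forward of \<open>x\<close> along the map from elements to
  coordinates; the three branches of its definition are the three kinds of fibres.\<close>

lemma xhat_eq: "xhat = (\<lambda>e\<in>{1..d}. sum x (K e))"
proof
  fix e
  show "xhat e = (\<lambda>e\<in>{1..d}. sum x (K e)) e"
  proof (cases e rule: fibre_cases)
    case (1 b)
    then show ?thesis by (simp add: alg_xhat_def fibre_R inv_into_f_f[OF inj_R] del: One_nat_def atLeastAtMost_iff)
  next
    case (2 i)
    moreover have "C i \<notin> R ` {1..m}" using C_neq_R 2 by auto
    ultimately show ?thesis by (simp add: alg_xhat_def fibre_C inv_into_f_f[OF inj_C])
  next
    case 3
    then show ?thesis by (simp add: alg_xhat_def fibre_empty)
  qed
qed

text \<open>A push-forward preserves total mass, so the hashed vector is an admissible input for the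
  dominance of pivotal sampling.\<close>

lemma xhat_Delta:
  assumes "l1_norm n x \<le> real k"
  shows "xhat \<in> Delta d k"
proof -
  have "l1_norm d xhat = (\<Sum>e\<in>{1..d}. sum x (K e))"
    using sum_fibre by (simp add: l1_norm_def xhat_eq)
  also have "\<dots> = sum x (\<Union>e\<in>{1..d}. K e)"
    using disjoint_fibre[of "{1..d}"] finite_fibre
    by (intro sum.UNION_disjoint[symmetric]) (auto simp: disjoint_family_on_def)
  also have "\<dots> \<le> l1_norm n x"
    unfolding l1_norm_def Union_fibre using x by (intro order.trans[OF sum_mono sum_mono2]) auto
  finally have "l1_norm d xhat \<le> real k" using assms by simp
  moreover have "xhat \<in> {1..d} \<rightarrow>\<^sub>E {0..1}"
    using sum_fibre by (auto simp: xhat_eq)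
  ultimately show ?thesis by (simp add: Delta_def)
qed

text \<open>Normalizing by the bucket weight multiplies every ratio by the same positive number,
  which leaves the set of minimizers, and hence the chosen one, unchanged.\<close>

lemma alg_rep_eq:
  assumes "b \<in> {1..m}" "0 < sum x (S \<inter> alg_bucket n \<beta> b)"
  shows "alg_rep n x S \<beta> E b = race x E (K (R b))"
proof -
  let ?K = "S \<inter> alg_bucket n \<beta> b"
  let ?p = "\<lambda>i. if i \<in> ?K then x i / sum x ?K else 0"
  have supp: "{i \<in> {1..n}. ?p i > 0} = ?K"
    using assms(2) by (auto simp: alg_small_def)
  have "minimizers (\<lambda>i. E i / ?p i) ?K = minimizers (\<lambda>i. E i / x i) ?K"
  proof -
    have "E i / ?p i = sum x ?K * (E i / x i)" if "i \<in> ?K" for i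
      using that by simp
    moreover have "sum x ?K * u \<le> sum x ?K * v \<longleftrightarrow> u \<le> v" for u v
      using assms(2) by simp
    ultimately show ?thesis unfolding minimizers_def by (intro Collect_cong) (metis (no_types, lifting))
  qed
  moreover have "?K \<noteq> {}" using assms(2) by (intro notI) simp
  ultimately show ?thesis
    unfolding alg_rep_def A1_def supp race_def fibre_R[OF assms(1)]
    by (simp add: arg_min_on_minimizers)
qed

text \<open>A selected large element wins its one-runner race. Buckets of weight 0 and coordinates
  hit by nothing have empty fibres and contribute nothing on either side.\<close>

lemma alg_main_eq:
  assumes "T \<subseteq> {1..d}"
  shows "alg_main n m x S L R C \<beta> E T = (\<Union>e\<in>T. race x E (K e))"
proof -
  have race_C: "race x E (K (C i)) = {i}" if "i \<in> L" for i
    using arg_min_on_in[of "{i}"] by (simp add: fibre_C[OF that] race_def)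
  have race_R: "race x E (K (R b)) = (if 0 < sum x (S \<inter> alg_bucket n \<beta> b) then alg_rep n x S \<beta> E b else {})"
    if "b \<in> {1..m}" for b
  proof (cases "K (R b) = {}")
    case False
    then have "0 < sum x (S \<inter> alg_bucket n \<beta> b)"
      using fibre_pos finite_fibre unfolding fibre_R[OF that, symmetric] by (intro sum_pos) auto
    then show ?thesis using alg_rep_eq[OF that] by simp
  next
    case True
    then show ?thesis using fibre_R[OF that] by (simp add: race_def)
  qed
  show ?thesis
  proof (intro set_eqI iffI)
    fix i assume "i \<in> alg_main n m x S L R C \<beta> E T"
    then consider "i \<in> L" "C i \<in> T" | b where "b \<in> {1..m}" "0 < sum x (S \<inter> alg_bucket n \<beta> b)"
        "R b \<in> T" "i \<in> alg_rep n x S \<beta> E b"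
      unfolding alg_main_def by blast
    then show "i \<in> (\<Union>e\<in>T. race x E (K e))"
    proof cases
      case 1
      then have "i \<in> race x E (K (C i))" by (simp add: race_C)
      with 1 show ?thesis by blast
    next
      case 2
      then have "i \<in> race x E (K (R b))" by (simp add: race_R)
      with 2 show ?thesis by blast
    qed
  next
    fix i assume "i \<in> (\<Union>e\<in>T. race x E (K e))"
    then obtain e where e: "e \<in> T" "i \<in> race x E (K e)" by auto
    show "i \<in> alg_main n m x S L R C \<beta> E T"
    proof (cases e rule: fibre_cases)
      case (1 b)
      then show ?thesis using e race_R[of b] unfolding alg_main_def by (auto split: if_splits)
    next
      case (2 j)
      then show ?thesis using e race_C[of j] unfolding alg_main_def by auto
    next
      case 3
      then show ?thesis using e by (simp add: fibre_empty race_def)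
    qed
  qed
qed

lemma race_fibre_subset: "race x E (K e) \<subseteq> {1..n}"
  using race_subset[OF finite_fibre] fibre_subset by blast

lemma measurable_race_output:
  "(\<lambda>(\<theta>, E). \<Union>e\<in>tree_pivotal t \<theta> z. race x E (K e))
    \<in> measurable (pivot_space t \<Otimes>\<^sub>M exp_clocks n) (count_space (Pow {1..n}))"
proof (rule measurable_into_Pow)
  let ?Q = "pivot_space t \<Otimes>\<^sub>M exp_clocks n"
  fix i
  have T: "{q \<in> space ?Q. e \<in> tree_pivotal t (fst q) z} \<in> sets ?Q" for e
    by (rule measurable_sets_Collect[OF measurable_fst sets_mem_tree_pivotal])
  have race: "{q \<in> space ?Q. i \<in> race x (snd q) (K e)} \<in> sets ?Q" for e
  proof -
    have "{E \<in> space (exp_clocks n). i \<in> race x E (K e)} \<in> sets (exp_clocks n)"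
      unfolding exp_clocks_def using fibre_subset by (intro sets_mem_race) auto
    then show ?thesis by (rule measurable_sets_Collect[OF measurable_snd])
  qed
  have "{q \<in> space ?Q. i \<in> (case q of (\<theta>, E) \<Rightarrow> \<Union>e\<in>tree_pivotal t \<theta> z. race x E (K e))} =
      {q \<in> space ?Q. \<exists>e\<in>set (tree_leaves t). e \<in> tree_pivotal t (fst q) z \<and> i \<in> race x (snd q) (K e)}"
    by (auto simp: tree_pivotal_eq)
  also have "\<dots> \<in> sets ?Q"
    by (intro sets.sets_Collect_finite_Ex sets.sets_Collect_conj T race) auto
  finally show "{q \<in> space ?Q. i \<in> (case q of (\<theta>, E) \<Rightarrow> \<Union>e\<in>tree_pivotal t \<theta> z. race x E (K e))} \<in> sets ?Q" .
next
  show "(case q of (\<theta>, E) \<Rightarrow> \<Union>e\<in>tree_pivotal t \<theta> z. race x E (K e)) \<subseteq> {1..n}" for q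
    using race_fibre_subset by (cases q) auto
qed simp

lemma alg_main_dominance:
  assumes t: "distinct (tree_leaves t)" "set (tree_leaves t) = {1..d}"
    and dom: "submodular_dominance (pivot_space t) {1..d} (Delta d k) (tree_pivotal t)"
    and k: "l1_norm n x \<le> real k" and f: "submodular_on {1..n} f"
  shows "multilinear_extension {1..n} f x \<le>
    (LINT \<theta>|pivot_space t. LINT E|exp_clocks n. f (alg_main n m x S L R C \<beta> E (tree_pivotal t \<theta> xhat)))"
proof -
  let ?P = "pivot_space t" and ?E = "exp_clocks n"
  interpret P: prob_space ?P by (rule prob_space_pivot_space)
  interpret E: prob_space ?E unfolding exp_clocks_def by (intro prob_space_PiM prob_space_exp1)
  interpret PE: pair_prob_space ?P ?E ..
  let ?U = "\<lambda>\<theta> E. \<Union>e\<in>tree_pivotal t \<theta> xhat. race x E (K e)"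
  let ?s = "\<lambda>e. sum x (K e)"
  let ?g = "\<lambda>E T. f (\<Union>e\<in>T. race x E (K e))"
  note race_sub = race_fibre_subset
  have T_sub: "tree_pivotal t \<theta> xhat \<subseteq> {1..d}" for \<theta>
    using tree_pivotal_subset[of t] unfolding t(2) .
  obtain B where B: "\<And>V. V \<subseteq> {1..n} \<Longrightarrow> \<bar>f V\<bar> \<le> B" using bounded_on_Pow[of "{1..n}" f] by auto
  have bound: "\<bar>?g E T\<bar> \<le> B" for E T using race_sub by (intro B) blast
  have "(\<lambda>(\<theta>, E). ?U \<theta> E) \<in> measurable (?P \<Otimes>\<^sub>M ?E) (count_space (Pow {1..n}))"
    by (rule measurable_race_output)
  then have "(\<lambda>q. f ((\<lambda>(\<theta>, E). ?U \<theta> E) q)) \<in> borel_measurable (?P \<Otimes>\<^sub>M ?E)"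
    by (rule measurable_compose) simp
  then have meas: "(\<lambda>(\<theta>, E). f (?U \<theta> E)) \<in> borel_measurable (?P \<Otimes>\<^sub>M ?E)"
    by (simp add: case_prod_beta)
  have int: "integrable (?P \<Otimes>\<^sub>M ?E) (\<lambda>(\<theta>, E). f (?U \<theta> E))"
    using bound meas by (intro PE.P.integrable_const_bound[where B=B]) auto
  have E_meas: "(\<lambda>E. multilinear_extension {1..d} (?g E) ?s) \<in> borel_measurable ?E"
  proof (intro borel_measurable_multilinear_extension)
    fix T :: "nat set" assume "T \<subseteq> {1..d}"
    then have "(\<lambda>E. {} \<union> (\<Union>e\<in>T. race x E (K e))) \<in> measurable ?E (count_space (Pow {1..n}))"
      unfolding exp_clocks_def using fibre_subset
      by (intro measurable_race_union) (auto intro: finite_subset)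
    then show "(\<lambda>E. ?g E T) \<in> borel_measurable ?E"
      by (auto dest: measurable_compose[where g=f and L=borel])
  qed simp
  have "multilinear_extension {1..n} f x = multilinear_extension (\<Union>e\<in>{1..d}. K e) f x"
    unfolding Union_fibre using x by (intro multilinear_extension_zero) (auto simp: less_le)
  also have "\<dots> \<le> (LINT E|?E. multilinear_extension {1..d} (?g E) ?s)"
    unfolding exp_clocks_def
    using disjoint_fibre fibre_subset fibre_pos sum_fibre f by (intro race_rounding) auto
  \<comment> \<open>The clocks are outermost here: for each fixed \<open>E\<close> the function
    \<open>?g E\<close> of the selected coordinates is submodular, and the marginals of the
    selection are the fibre weights.\<close>
  also have "\<dots> \<le> (LINT E|?E. LINT \<theta>|?P. f (?U \<theta> E))"
  proof (rule integral_mono)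
    show "integrable ?E (\<lambda>E. multilinear_extension {1..d} (?g E) ?s)"
      using bound sum_fibre E_meas
      by (intro E.integrable_const_bound[where B=B]) (auto intro!: abs_multilinear_extension_le)
    show "integrable ?E (\<lambda>E. LINT \<theta>|?P. f (?U \<theta> E))"
      using PE.integrable_snd[OF int] .
    fix E
    have "submodular_on {1..d} (?g E)"
    proof (rule submodular_on_disjoint_union[OF f race_sub])
      show "disjoint_family_on (\<lambda>e. race x E (K e)) {1..d}"
        using disjoint_fibre[of "{1..d}"] race_subset[OF finite_fibre, of x E]
        unfolding disjoint_family_on_def by blast
    qed (simp add: race_def)
    then have "multilinear_extension {1..d} (?g E) (\<lambda>j. LINT \<theta>|?P. indicator (tree_pivotal t \<theta> xhat) j)
        \<le> (LINT \<theta>|?P. f (?U \<theta> E))"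
      using dom xhat_Delta[OF k] unfolding submodular_dominance_def by blast
    moreover have "(LINT \<theta>|?P. indicator (tree_pivotal t \<theta> xhat) j) = ?s j" if "j \<in> {1..d}" for j
      using tree_pivotal_marginal[OF t(1), of xhat j] sum_fibre that unfolding t(2)
      by (simp add: xhat_eq)
    then have "multilinear_extension {1..d} (?g E) (\<lambda>j. LINT \<theta>|?P. indicator (tree_pivotal t \<theta> xhat) j)
        = multilinear_extension {1..d} (?g E) ?s"
      by (intro multilinear_extension_cong refl)
    ultimately show "multilinear_extension {1..d} (?g E) ?s \<le> (LINT \<theta>|?P. f (?U \<theta> E))" by simp
  qed
  also have "\<dots> = (LINT \<theta>|?P. LINT E|?E. f (?U \<theta> E))"
    by (rule PE.Fubini_integral[OF int])
  finally show ?thesis by (simp add: alg_main_eq[OF T_sub])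
qed

end


section \<open>Measurability of the composed algorithm\<close>

abbreviation unif10 :: "real measure" where
  "unif10 \<equiv> uniform_measure lborel {0..1/10}"

text \<open>The part of the randomness that is held fixed in the argument. Products associate to the
  right, so it is a factor of \<open>alg_space\<close> as it stands.\<close>

definition alg_hash_space ::
    "nat \<Rightarrow> nat \<Rightarrow> real \<Rightarrow> ((nat \<Rightarrow> nat) \<times> (nat \<Rightarrow> nat) \<times> (nat \<Rightarrow> nat) \<times> real \<times> real) measure" where
  "alg_hash_space n k \<alpha> =
    PiM {1..num_buckets k \<alpha>} (\<lambda>_. uniform_count_measure {1..hash_dim k \<alpha>}) \<Otimes>\<^sub>M
    PiM {1..n} (\<lambda>_. uniform_count_measure {1..hash_dim k \<alpha>}) \<Otimes>\<^sub>M
    PiM {1..n} (\<lambda>_. uniform_count_measure {1..num_buckets k \<alpha>}) \<Otimes>\<^sub>M unif10 \<Otimes>\<^sub>M unif10"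

lemma alg_space_eq:
  "alg_space n k \<alpha> M t = M \<Otimes>\<^sub>M exp_clocks n \<Otimes>\<^sub>M pivot_space t \<Otimes>\<^sub>M alg_hash_space n k \<alpha>"
  by (simp add: alg_space_def alg_hash_space_def Let_def)

lemma prob_space_unif10: "prob_space unif10"
  by (rule prob_space_uniform_measure) auto

lemma prob_space_exp_clocks: "prob_space (exp_clocks n)"
  unfolding exp_clocks_def by (intro prob_space_PiM prob_space_exp1)

text \<open>Guarantees that the uniform distributions on buckets and coordinates have nonempty
  support.\<close>

lemma num_buckets_pos:
  assumes "1 \<le> k" "0 < \<alpha>"
  shows "1 \<le> num_buckets k \<alpha>" "1 \<le> hash_dim k \<alpha>"
proof -
  have "0 < 2 ^ 5 * real k ^ 5 * \<alpha> ^ 5" using assms by simp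
  then show "1 \<le> num_buckets k \<alpha>" unfolding num_buckets_def by linarith
  then show "1 \<le> hash_dim k \<alpha>" unfolding hash_dim_def by simp
qed

lemma prob_space_alg_hash_space:
  assumes "1 \<le> k" "0 < \<alpha>"
  shows "prob_space (alg_hash_space n k \<alpha>)"
  unfolding alg_hash_space_def using num_buckets_pos[OF assms]
  by (intro prob_space_pair prob_space_PiM prob_space_uniform_count_measure prob_space_unif10) auto

lemma prob_space_alg_space:
  assumes "1 \<le> k" "0 < \<alpha>" "prob_space M"
  shows "prob_space (alg_space n k \<alpha> M t)"
  unfolding alg_space_eq
  by (intro prob_space_pair assms prob_space_alg_hash_space prob_space_exp_clocks prob_space_pivot_space)

lemma AE_pair_snd:
  assumes "prob_space M" "prob_space N" "AE y in N. P y" "{y \<in> space N. P y} \<in> sets N"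
  shows "AE p in M \<Otimes>\<^sub>M N. P (snd p)"
proof -
  interpret M: prob_space M by fact
  interpret N: prob_space N by fact
  interpret pair_prob_space M N ..
  show ?thesis
  proof (rule AE_pair_measure)
    show "{p \<in> space (M \<Otimes>\<^sub>M N). P (snd p)} \<in> sets (M \<Otimes>\<^sub>M N)"
      using assms(4) by (rule measurable_sets_Collect[OF measurable_snd])
  qed (use assms(3) in simp)
qed

text \<open>The bound on \<open>\<sigma>\<close> makes large elements positive, and the one on
  \<open>\<tau>\<close> turns \<open>1 - \<tau>\<close> into the weight bound 1. Both hold only
  almost everywhere, because the underlying space of each threshold is the whole real line.\<close>

lemma AE_alg_hash_space:
  assumes "1 \<le> k" "0 < \<alpha>"
  shows "AE (R, C, \<beta>, \<sigma>, \<tau>) in alg_hash_space n k \<alpha>. 0 \<le> \<sigma> \<and> 0 \<le> \<tau>"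
proof -
  note m = num_buckets_pos[OF assms]
  interpret U: prob_space unif10 by (rule prob_space_unif10)
  interpret UU: pair_prob_space unif10 unif10 ..
  have "AE u in unif10. 0 \<le> u"
    by (rule AE_uniform_measureI) auto
  moreover have **: "{p \<in> space (unif10 \<Otimes>\<^sub>M unif10). 0 \<le> fst p \<and> 0 \<le> snd p} \<in> sets (unif10 \<Otimes>\<^sub>M unif10)"
    by measurable
  ultimately have *: "AE p in unif10 \<Otimes>\<^sub>M unif10. 0 \<le> fst p \<and> 0 \<le> snd p"
    by (intro UU.AE_pair_measure[OF **]) simp
  have "AE q in alg_hash_space n k \<alpha>. 0 \<le> fst (snd (snd (snd q))) \<and> 0 \<le> snd (snd (snd (snd q)))"
    unfolding alg_hash_space_def using m
    by (intro AE_pair_snd prob_space_pair prob_space_PiM prob_space_uniform_count_measure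
        prob_space_unif10 * **
        measurable_sets_Collect[OF measurable_snd, where P="\<lambda>p. 0 \<le> fst p \<and> 0 \<le> snd p"]
        measurable_sets_Collect[OF measurable_snd, where P="\<lambda>p. 0 \<le> fst (snd p) \<and> 0 \<le> snd (snd p)"]) auto
  then show ?thesis by (simp add: case_prod_beta)
qed

lemma sets_PiM_uniform_count:
  assumes "finite I" "finite D"
  shows "sets (PiM I (\<lambda>_. uniform_count_measure D)) = Pow (PiE I (\<lambda>_. D))"
proof -
  have "sets (PiM I (\<lambda>_. uniform_count_measure D)) = sets (PiM I (\<lambda>_. count_space D))"
    by (intro sets_PiM_cong refl) (simp add: sets_uniform_count_measure)
  then show ?thesis using assms by (simp add: count_space_PiM_finite countable_finite)
qed

text \<open>Fubini together with measurability and the same bound for the inner integral, so that it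
  can be iterated over a nested product.\<close>

lemma integral_pair_swap_bounded:
  fixes g :: "'a \<times> 'b \<Rightarrow> real"
  assumes "prob_space A" "prob_space B" "g \<in> borel_measurable (A \<Otimes>\<^sub>M B)"
    and bound: "\<And>a b. a \<in> space A \<Longrightarrow> b \<in> space B \<Longrightarrow> \<bar>g (a, b)\<bar> \<le> c"
  shows "(LINT p|(A \<Otimes>\<^sub>M B). g p) = (LINT b|B. LINT a|A. g (a, b))"
    and "(\<lambda>b. LINT a|A. g (a, b)) \<in> borel_measurable B"
    and "\<And>b. b \<in> space B \<Longrightarrow> \<bar>LINT a|A. g (a, b)\<bar> \<le> c"
proof -
  interpret A: prob_space A by fact
  interpret B: prob_space B by fact
  interpret AB: pair_prob_space A B ..
  interpret BA: pair_prob_space B A ..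
  have int: "integrable (A \<Otimes>\<^sub>M B) (\<lambda>(a, b). g (a, b))"
    using assms(3) bound by (intro AB.P.integrable_const_bound[where B=c]) (auto simp: space_pair_measure)
  show "(LINT p|(A \<Otimes>\<^sub>M B). g p) = (LINT b|B. LINT a|A. g (a, b))"
    using AB.integral_snd[OF int] by simp
  show "(\<lambda>b. LINT a|A. g (a, b)) \<in> borel_measurable B"
    using assms(3) by measurable
  fix b assume b: "b \<in> space B"
  have "(\<lambda>a. g (a, b)) \<in> borel_measurable A" using assms(3) b by measurable
  then have int_b: "integrable A (\<lambda>a. g (a, b))"
    using bound b by (intro A.integrable_const_bound[where B=c]) auto
  have "- c \<le> g (a, b) \<and> g (a, b) \<le> c" if "a \<in> space A" for a
    using bound[OF that b] by (simp add: abs_le_iff minus_le_iff)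
  then have "- c \<le> (LINT a|A. g (a, b))" "(LINT a|A. g (a, b)) \<le> c"
    using int_b by (auto intro!: A.integral_ge_const A.integral_le_const AE_I2)
  then show "\<bar>LINT a|A. g (a, b)\<bar> \<le> c" by simp
qed

section \<open>Range and measurability of the output\<close>

lemma A1_subset:
  assumes "i \<in> {1..n}" "p i > 0"
  shows "A1 n E p \<subseteq> {1..n}"
  using arg_min_on_in[of "{i \<in> {1..n}. p i > 0}" "\<lambda>i. E i / p i"] assms by (auto simp: A1_def)

text \<open>Positive bucket weight provides an element in the support of the probability vector; on
  empty support \<open>arg_min_on\<close> could return any number.\<close>

lemma alg_rep_subset:
  assumes x: "\<And>i. i \<in> {1..n} \<Longrightarrow> 0 \<le> x i" and S: "S \<subseteq> {1..n}"
    and pos: "0 < sum x (S \<inter> alg_bucket n \<beta> b)"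
  shows "alg_rep n x S \<beta> E b \<subseteq> {1..n}"
proof -
  obtain i where "i \<in> S \<inter> alg_bucket n \<beta> b" "0 < x i"
    using pos by (metis not_le sum_nonpos)
  then show ?thesis unfolding alg_rep_def using S pos by (intro A1_subset[of i]) auto
qed

lemma sets_mem_alg_rep:
  "{E \<in> space (exp_clocks n). i \<in> alg_rep n x S \<beta> E b} \<in> sets (exp_clocks n)"
proof -
  let ?p = "\<lambda>i. if i \<in> S \<inter> alg_bucket n \<beta> b then x i / sum x (S \<inter> alg_bucket n \<beta> b) else 0"
  let ?K = "{i \<in> {1..n}. ?p i > 0}"
  have "(\<lambda>E. arg_min_on (\<lambda>j. E j / ?p j) ?K) \<in> measurable (exp_clocks n) (count_space UNIV)"
    unfolding exp_clocks_def
    by (intro measurable_arg_min_on borel_measurable_divide borel_measurable_const) auto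
  then have "{E \<in> space (exp_clocks n). i = arg_min_on (\<lambda>j. E j / ?p j) ?K} \<in> sets (exp_clocks n)"
    by measurable
  then show ?thesis unfolding alg_rep_def A1_def singleton_iff .
qed

lemma ALG_subset:
  assumes "\<And>i. i \<in> {1..n} \<Longrightarrow> 0 \<le> x i" "A (fst q) x \<subseteq> {1..n}"
  shows "ALG n k \<alpha> A t q x \<subseteq> {1..n}"
proof -
  obtain \<omega> E \<theta> R C \<beta> \<sigma> \<tau> where q: "q = (\<omega>, E, \<theta>, R, C, \<beta>, \<sigma>, \<tau>)" by (cases q) auto
  have S: "alg_small n x \<sigma> \<subseteq> {1..n}" by (auto simp: alg_small_def)
  have L: "alg_large n x \<sigma> \<subseteq> {1..n}" by (auto simp: alg_large_def)
  have rep: "alg_rep n x (alg_small n x \<sigma>) \<beta> E b \<subseteq> {1..n}"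
    if "0 < sum x (alg_small n x \<sigma> \<inter> alg_bucket n \<beta> b)" for b
    by (rule alg_rep_subset[OF _ S that]) (rule assms(1))
  have "alg_main n m x (alg_small n x \<sigma>) (alg_large n x \<sigma>) R C \<beta> E T \<subseteq> {1..n}" for m T
    unfolding alg_main_def using rep L by blast
  then show ?thesis using assms(2) by (simp add: q ALG_eq Let_def)
qed

text \<open>Once the discrete data are fixed, the event \<open>i \<in> ALG\<close> is a finite
  Boolean combination of events about \<open>A\<close>, the clocks, the pivot variables and
  \<open>\<tau>\<close>. There are finitely many values of the discrete data to glue.\<close>

lemma measurable_ALG:
  assumes A: "(\<lambda>\<omega>. A \<omega> x) \<in> measurable M (count_space (Pow {1..n}))"
    and x: "\<And>i. i \<in> {1..n} \<Longrightarrow> 0 \<le> x i"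
  shows "(\<lambda>q. ALG n k \<alpha> A t q x) \<in> measurable (alg_space n k \<alpha> M t) (count_space (Pow {1..n}))"
proof (rule measurable_into_Pow)
  let ?Q = "alg_space n k \<alpha> M t" and ?m = "num_buckets k \<alpha>" and ?d = "hash_dim k \<alpha>"
  show "ALG n k \<alpha> A t q x \<subseteq> {1..n}" if "q \<in> space ?Q" for q
  proof (rule ALG_subset[OF x])
    have "fst q \<in> space M" using that by (auto simp: alg_space_eq space_pair_measure)
    then show "A (fst q) x \<subseteq> {1..n}" using measurable_space[OF A] by simp
  qed
  fix i
  let ?\<omega> = "\<lambda>q. fst q" and ?E = "\<lambda>q. fst (snd q)" and ?\<theta> = "\<lambda>q. fst (snd (snd q))"
    and ?R = "\<lambda>q. fst (snd (snd (snd q)))" and ?C = "\<lambda>q. fst (snd (snd (snd (snd q))))"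
    and ?\<beta> = "\<lambda>q. fst (snd (snd (snd (snd (snd q)))))"
    and ?\<sigma> = "\<lambda>q. fst (snd (snd (snd (snd (snd (snd q))))))"
    and ?\<tau> = "\<lambda>q. snd (snd (snd (snd (snd (snd (snd q))))))"
  have proj: "?\<omega> \<in> measurable ?Q M" "?E \<in> measurable ?Q (exp_clocks n)" "?\<theta> \<in> measurable ?Q (pivot_space t)"
    "?R \<in> measurable ?Q (PiM {1..?m} (\<lambda>_. uniform_count_measure {1..?d}))"
    "?C \<in> measurable ?Q (PiM {1..n} (\<lambda>_. uniform_count_measure {1..?d}))"
    "?\<beta> \<in> measurable ?Q (PiM {1..n} (\<lambda>_. uniform_count_measure {1..?m}))"
    unfolding alg_space_eq alg_hash_space_def by measurable
  have [measurable]: "?\<sigma> \<in> borel_measurable ?Q" "?\<tau> \<in> borel_measurable ?Q"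
    unfolding alg_space_eq alg_hash_space_def by measurable
  \<comment> \<open>The variable \<open>\<sigma>\<close> enters only through the sets of small and
    large elements, which keeps the key finite-valued.\<close>
  let ?key = "\<lambda>q. (?R q, ?C q, ?\<beta> q, alg_small n x (?\<sigma> q), alg_large n x (?\<sigma> q))"
  let ?keys = "PiE {1..?m} (\<lambda>_. {1..?d}) \<times> PiE {1..n} (\<lambda>_. {1..?d}) \<times> PiE {1..n} (\<lambda>_. {1..?m}) \<times>
    Pow {1..n} \<times> Pow {1..n}"
  let ?F = "\<lambda>(R, C, \<beta>, S, L) q. if alg_fallback n ?m x S L R C \<beta> (?\<tau> q) then i \<in> A (?\<omega> q) x
    else i \<in> alg_main n ?m x S L R C \<beta> (?E q) (tree_pivotal t (?\<theta> q) (alg_xhat n ?m ?d x S L R C \<beta>))"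
  have eqs: "{q \<in> space ?Q. ?R q = R} \<in> sets ?Q" "{q \<in> space ?Q. ?C q = C} \<in> sets ?Q"
    "{q \<in> space ?Q. ?\<beta> q = \<beta>} \<in> sets ?Q" for R C \<beta>
    by (rule measurable_sets_Collect[OF proj(4)] measurable_sets_Collect[OF proj(5)]
        measurable_sets_Collect[OF proj(6)]; force simp: sets_PiM_uniform_count space_PiM space_uniform_count_measure)+
  have small: "(\<lambda>q. alg_small n x (?\<sigma> q)) \<in> measurable ?Q (count_space (Pow {1..n}))"
    "(\<lambda>q. alg_large n x (?\<sigma> q)) \<in> measurable ?Q (count_space (Pow {1..n}))"
    by (rule measurable_into_Pow; force simp: alg_small_def alg_large_def)+
  have "?key \<in> measurable ?Q (count_space ?keys)"
  proof (subst measurable_count_space_eq2)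
    show "finite ?keys" by (intro finite_cartesian_product finite_PiE) auto
    have "?key q \<in> ?keys" if "q \<in> space ?Q" for q
    proof -
      have "?R q \<in> PiE {1..?m} (\<lambda>_. {1..?d})" "?C q \<in> PiE {1..n} (\<lambda>_. {1..?d})"
        "?\<beta> q \<in> PiE {1..n} (\<lambda>_. {1..?m})"
        using measurable_space[OF proj(4) that] measurable_space[OF proj(5) that]
          measurable_space[OF proj(6) that]
        by (simp_all only: space_PiM space_uniform_count_measure)
      moreover have "alg_small n x (?\<sigma> q) \<in> Pow {1..n}" "alg_large n x (?\<sigma> q) \<in> Pow {1..n}"
        by (auto simp: alg_small_def alg_large_def)
      ultimately show ?thesis by (intro SigmaI)
    qed
    moreover have "?key -` {r} \<inter> space ?Q \<in> sets ?Q" if "r \<in> ?keys" for r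
    proof -
      obtain R C \<beta> S L where r: "r = (R, C, \<beta>, S, L)" by (cases r)
      have "{q \<in> space ?Q. alg_small n x (?\<sigma> q) = S} \<in> sets ?Q"
        "{q \<in> space ?Q. alg_large n x (?\<sigma> q) = L} \<in> sets ?Q"
        using small that unfolding r by measurable
      then have "{q \<in> space ?Q. ?R q = R \<and> ?C q = C \<and> ?\<beta> q = \<beta> \<and> alg_small n x (?\<sigma> q) = S \<and>
          alg_large n x (?\<sigma> q) = L} \<in> sets ?Q"
        by (intro sets.sets_Collect_conj eqs)
      also have "{q \<in> space ?Q. ?R q = R \<and> ?C q = C \<and> ?\<beta> q = \<beta> \<and> alg_small n x (?\<sigma> q) = S \<and>
          alg_large n x (?\<sigma> q) = L} = ?key -` {r} \<inter> space ?Q"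
        unfolding r by auto
      finally show ?thesis .
    qed
    ultimately show "?key \<in> space ?Q \<rightarrow> ?keys \<and> (\<forall>r\<in>?keys. ?key -` {r} \<inter> space ?Q \<in> sets ?Q)"
      by (intro conjI ballI funcsetI)
  qed
  moreover have "?F r \<in> measurable ?Q (count_space UNIV)" for r
  proof -
    obtain R C \<beta> S L where r: "r = (R, C, \<beta>, S, L)" by (cases r)
    let ?z = "alg_xhat n ?m ?d x S L R C \<beta>"
    have T: "{q \<in> space ?Q. e \<in> tree_pivotal t (?\<theta> q) ?z} \<in> sets ?Q" for e
      by (rule measurable_sets_Collect[OF proj(3) sets_mem_tree_pivotal])
    have rep: "{q \<in> space ?Q. i \<in> alg_rep n x S \<beta> (?E q) b} \<in> sets ?Q" for b
      by (rule measurable_sets_Collect[OF proj(2) sets_mem_alg_rep])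
    have fall: "{q \<in> space ?Q. alg_fallback n ?m x S L R C \<beta> (?\<tau> q)} \<in> sets ?Q"
      unfolding alg_fallback_def by measurable
    have "{\<omega> \<in> space M. i \<in> A \<omega> x} \<in> sets M"
    proof -
      have "(\<lambda>\<omega>. A \<omega> x) -` {V \<in> Pow {1..n}. i \<in> V} \<inter> space M \<in> sets M"
        using A by (rule measurable_sets) auto
      moreover have "(\<lambda>\<omega>. A \<omega> x) -` {V \<in> Pow {1..n}. i \<in> V} \<inter> space M = {\<omega> \<in> space M. i \<in> A \<omega> x}"
        using measurable_space[OF A] by auto
      ultimately show ?thesis by simp
    qed
    then have AA: "{q \<in> space ?Q. i \<in> A (?\<omega> q) x} \<in> sets ?Q"
      by (rule measurable_sets_Collect[OF proj(1)])
    have "{q \<in> space ?Q. i \<in> alg_main n ?m x S L R C \<beta> (?E q) (tree_pivotal t (?\<theta> q) ?z)} =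
        {q \<in> space ?Q. (i \<in> L \<and> C i \<in> tree_pivotal t (?\<theta> q) ?z) \<or>
          (\<exists>b\<in>{b \<in> {1..?m}. 0 < sum x (S \<inter> alg_bucket n \<beta> b)}.
            R b \<in> tree_pivotal t (?\<theta> q) ?z \<and> i \<in> alg_rep n x S \<beta> (?E q) b)}"
      unfolding alg_main_def by blast
    also have "\<dots> \<in> sets ?Q"
      by (intro sets.sets_Collect_disj sets.sets_Collect_conj sets.sets_Collect_finite_Ex T rep
          sets.sets_Collect_const) auto
    finally have main: "{q \<in> space ?Q. i \<in> alg_main n ?m x S L R C \<beta> (?E q) (tree_pivotal t (?\<theta> q) ?z)} \<in> sets ?Q" .
    show ?thesis
      unfolding r prod.case using fall AA main
      by (intro measurable_If) (auto simp: pred_def)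
  qed
  ultimately have "(\<lambda>q. ?F (?key q) q) \<in> measurable ?Q (count_space UNIV)"
    by (intro measurable_compose_countable'[where f="?F" and g="?key" and I="?keys"] countable_finite
        finite_cartesian_product finite_PiE) auto
  moreover have "i \<in> ALG n k \<alpha> A t q x \<longleftrightarrow> ?F (?key q) q" for q
  proof -
    obtain \<omega> E \<theta> R C \<beta> \<sigma> \<tau> where q: "q = (\<omega>, E, \<theta>, R, C, \<beta>, \<sigma>, \<tau>)" by (cases q) auto
    show ?thesis by (simp add: q ALG_eq Let_def)
  qed
  ultimately show "{q \<in> space ?Q. i \<in> ALG n k \<alpha> A t q x} \<in> sets ?Q"
    by (simp add: pred_def)
qed simp


section \<open>Submodular dominance\<close>

lemma ALG_dominance:
  fixes M :: "'w measure"
  assumes "1 \<le> k" "0 < \<alpha>" and A: "stretch_correlated_sampling \<alpha> n k M A"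
    and t: "pivot_tree_for (hash_dim k \<alpha>) t"
    and A_dom: "submodular_dominance M {1..n} (Delta n k) A"
    and t_dom: "submodular_dominance (pivot_space t) {1..hash_dim k \<alpha>} (Delta (hash_dim k \<alpha>) k) (tree_pivotal t)"
    and x: "x \<in> Delta n k" and f: "submodular_on {1..n} f"
  shows "multilinear_extension {1..n} f x \<le> (LINT q|alg_space n k \<alpha> M t. f (ALG n k \<alpha> A t q x))"
proof -
  let ?m = "num_buckets k \<alpha>" and ?d = "hash_dim k \<alpha>"
  let ?E = "exp_clocks n" and ?P = "pivot_space t" and ?H = "alg_hash_space n k \<alpha>"
  interpret M: prob_space M using A_dom by (simp add: submodular_dominance_def randomized_procedure_def)
  interpret E: prob_space ?E by (rule prob_space_exp_clocks)
  interpret P: prob_space ?P by (rule prob_space_pivot_space)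
  interpret H: prob_space ?H by (rule prob_space_alg_hash_space) fact+
  note probs = prob_space_pair M.prob_space_axioms E.prob_space_axioms P.prob_space_axioms H.prob_space_axioms
  have l1: "l1_norm n x \<le> real k" using x by (simp add: Delta_def)
  have x01: "x i \<in> {0..1}" if "i \<in> {1..n}" for i using x that by (auto simp: Delta_def)
  then have x0: "0 \<le> x i" if "i \<in> {1..n}" for i using that by simp
  have A_meas: "(\<lambda>\<omega>. A \<omega> x) \<in> measurable M (count_space (Pow {1..n}))"
    using A_dom x by (simp add: submodular_dominance_def randomized_procedure_def)
  obtain B where B: "\<And>V. V \<subseteq> {1..n} \<Longrightarrow> \<bar>f V\<bar> \<le> B" using bounded_on_Pow[of "{1..n}" f] by auto
  let ?h = "\<lambda>q. f (ALG n k \<alpha> A t q x)"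
  have h_meas: "?h \<in> borel_measurable (M \<Otimes>\<^sub>M ?E \<Otimes>\<^sub>M ?P \<Otimes>\<^sub>M ?H)"
    unfolding alg_space_eq[symmetric]
    by (rule measurable_compose[OF measurable_ALG[where A=A and x=x, OF A_meas]]) (simp_all add: x0)
  have h_bound: "\<bar>?h (\<omega>, r)\<bar> \<le> B" if "\<omega> \<in> space M" for \<omega> r
    using x0 measurable_space[OF A_meas that] by (intro B ALG_subset) auto
  \<comment> \<open>Three applications of Fubini move the hash variables outermost, where the
    remaining integral can be estimated for almost every outcome. Each one supplies the
    measurability and boundedness for the next.\<close>
  have swap1: "(LINT q|(M \<Otimes>\<^sub>M ?E \<Otimes>\<^sub>M ?P \<Otimes>\<^sub>M ?H). ?h q) = (LINT r|(?E \<Otimes>\<^sub>M ?P \<Otimes>\<^sub>M ?H). LINT \<omega>|M. ?h (\<omega>, r))"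
    and m1: "(\<lambda>r. LINT \<omega>|M. ?h (\<omega>, r)) \<in> borel_measurable (?E \<Otimes>\<^sub>M ?P \<Otimes>\<^sub>M ?H)"
    and b1: "\<And>r. r \<in> space (?E \<Otimes>\<^sub>M ?P \<Otimes>\<^sub>M ?H) \<Longrightarrow> \<bar>LINT \<omega>|M. ?h (\<omega>, r)\<bar> \<le> B"
    by - (rule integral_pair_swap_bounded[OF _ _ h_meas h_bound]; (intro probs)?; assumption?)+
  have b1': "\<bar>LINT \<omega>|M. ?h (\<omega>, e, r)\<bar> \<le> B" if "e \<in> space ?E" "r \<in> space (?P \<Otimes>\<^sub>M ?H)" for e r
    using that by (intro b1) (simp add: space_pair_measure)
  have swap2: "(LINT r|(?E \<Otimes>\<^sub>M ?P \<Otimes>\<^sub>M ?H). LINT \<omega>|M. ?h (\<omega>, r)) =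
      (LINT r|(?P \<Otimes>\<^sub>M ?H). LINT e|?E. LINT \<omega>|M. ?h (\<omega>, e, r))"
    and m2: "(\<lambda>r. LINT e|?E. LINT \<omega>|M. ?h (\<omega>, e, r)) \<in> borel_measurable (?P \<Otimes>\<^sub>M ?H)"
    and b2: "\<And>r. r \<in> space (?P \<Otimes>\<^sub>M ?H) \<Longrightarrow> \<bar>LINT e|?E. LINT \<omega>|M. ?h (\<omega>, e, r)\<bar> \<le> B"
    by - (rule integral_pair_swap_bounded[OF _ _ m1 b1']; (intro probs)?; assumption?)+
  have b2': "\<bar>LINT e|?E. LINT \<omega>|M. ?h (\<omega>, e, \<theta>, r)\<bar> \<le> B" if "\<theta> \<in> space ?P" "r \<in> space ?H" for \<theta> r
    using that by (intro b2) (simp add: space_pair_measure)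
  have swap3: "(LINT r|(?P \<Otimes>\<^sub>M ?H). LINT e|?E. LINT \<omega>|M. ?h (\<omega>, e, r)) =
      (LINT r|?H. LINT \<theta>|?P. LINT e|?E. LINT \<omega>|M. ?h (\<omega>, e, \<theta>, r))"
    and m3: "(\<lambda>r. LINT \<theta>|?P. LINT e|?E. LINT \<omega>|M. ?h (\<omega>, e, \<theta>, r)) \<in> borel_measurable ?H"
    and b3: "\<And>r. r \<in> space ?H \<Longrightarrow> \<bar>LINT \<theta>|?P. LINT e|?E. LINT \<omega>|M. ?h (\<omega>, e, \<theta>, r)\<bar> \<le> B"
    by - (rule integral_pair_swap_bounded[OF _ _ m2 b2']; (intro probs)?; assumption?)+
  \<comment> \<open>Property (P2) identifies the marginals of \<open>A\<close> with
    \<open>x\<close>, which turns its dominance into a bound by the multilinear extension at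
    \<open>x\<close> itself.\<close>
  have A_int: "multilinear_extension {1..n} f x \<le> (LINT \<omega>|M. f (A \<omega> x))"
  proof -
    have "multilinear_extension {1..n} f (\<lambda>i. LINT \<omega>|M. indicator (A \<omega> x) i) \<le> (LINT \<omega>|M. f (A \<omega> x))"
      using A_dom x f by (simp add: submodular_dominance_def)
    moreover have "(LINT \<omega>|M. indicator (A \<omega> x) i) = x i" if "i \<in> {1..n}" for i
    proof -
      have "(LINT \<omega>|M. indicator (A \<omega> x) i :: real) = (LINT \<omega>|M. indicator {\<omega> \<in> space M. i \<in> A \<omega> x} \<omega>)"
        by (rule Bochner_Integration.integral_cong) (auto simp: indicator_def)
      also have "\<dots> = measure M {\<omega> \<in> space M. i \<in> A \<omega> x}"
        by (simp add: Int_def conj_commute)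
      also have "\<dots> = x i" using A x that by (simp add: stretch_correlated_sampling_def)
      finally show ?thesis .
    qed
    then have "multilinear_extension {1..n} f (\<lambda>i. LINT \<omega>|M. indicator (A \<omega> x) i) = multilinear_extension {1..n} f x"
      by (intro multilinear_extension_cong refl)
    ultimately show ?thesis by simp
  qed
  have "AE r in ?H. multilinear_extension {1..n} f x \<le> (LINT \<theta>|?P. LINT e|?E. LINT \<omega>|M. ?h (\<omega>, e, \<theta>, r))"
    using AE_alg_hash_space[OF assms(1,2), of n] AE_space
  proof eventually_elim
    case (elim r)
    obtain R C \<beta> \<sigma> \<tau> where r: "r = (R, C, \<beta>, \<sigma>, \<tau>)" by (cases r)
    let ?S = "alg_small n x \<sigma>" and ?L = "alg_large n x \<sigma>"
    show ?case
    \<comment> \<open>The choice of branch is decided by \<open>x\<close> and the hash variables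
      alone, so for fixed \<open>r\<close> it is the same for all outcomes of the three
      subroutines.\<close>
    proof (cases "alg_fallback n ?m x ?S ?L R C \<beta> \<tau>")
      case True
      then show ?thesis
        using A_int by (simp add: r ALG_eq E.prob_space P.prob_space)
    next
      case False
      have "R \<in> PiE {1..?m} (\<lambda>_. {1..?d})" "C \<in> PiE {1..n} (\<lambda>_. {1..?d})" "\<beta> \<in> PiE {1..n} (\<lambda>_. {1..?m})"
        using elim(2) unfolding r alg_hash_space_def space_pair_measure space_PiM
          space_uniform_count_measure by blast+
      moreover have "sum x (?S \<inter> alg_bucket n \<beta> b) \<le> 1" if "b \<in> {1..?m}" for b
      proof -
        have "sum x (?S \<inter> alg_bucket n \<beta> b) \<le> 1 - \<tau>"
          using False that unfolding alg_fallback_def by (meson not_less)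
        then show ?thesis using elim(1) by (simp add: r)
      qed
      ultimately interpret hashed_input n ?m ?d x \<sigma> R C \<beta>
        using False elim(1) x01 unfolding r alg_fallback_def
        by unfold_locales (auto simp: not_less PiE_mem simp del: One_nat_def)
      have "multilinear_extension {1..n} f x \<le>
          (LINT \<theta>|?P. LINT E|?E. f (alg_main n ?m x S L R C \<beta> E (tree_pivotal t \<theta> xhat)))"
        using t t_dom l1 f by (intro alg_main_dominance[where k=k]) (simp_all add: pivot_tree_for_def)
      then show ?thesis using False by (simp add: r ALG_eq Let_def M.prob_space)
    qed
  qed
  then have "multilinear_extension {1..n} f x \<le> (LINT r|?H. LINT \<theta>|?P. LINT e|?E. LINT \<omega>|M. ?h (\<omega>, e, \<theta>, r))"
    using b3 m3 by (intro H.integral_ge_const H.integrable_const_bound[where B=B]) auto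
  then show ?thesis using swap1 swap2 swap3 by (simp add: alg_space_eq)
qed

theorem theorem3p24:
  fixes n k :: nat and \<alpha> :: real
    and M :: "'w measure" and A :: "'w \<Rightarrow> (nat \<Rightarrow> real) \<Rightarrow> nat set"
    and t :: pivot_tree
  assumes "n \<ge> 1" and "k \<ge> 1" and "\<alpha> > 0"
    and "stretch_correlated_sampling \<alpha> n k M A"
    and "pivot_tree_for (hash_dim k \<alpha>) t"
    and "submodular_dominance M {1..n} (Delta n k) A"
    and "submodular_dominance (pivot_space t) {1..hash_dim k \<alpha>} (Delta (hash_dim k \<alpha>) k)
           (tree_pivotal t)"
  shows "submodular_dominance (alg_space n k \<alpha> M t) {1..n} (Delta n k) (ALG n k \<alpha> A t)"
proof -
  note dom = ALG_dominance[OF assms(2-)]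
  show ?thesis
    unfolding submodular_dominance_def randomized_procedure_def
  proof (intro conjI ballI allI impI)
    show "prob_space (alg_space n k \<alpha> M t)"
      using assms by (intro prob_space_alg_space) (auto simp: submodular_dominance_def randomized_procedure_def)
    fix x assume x: "x \<in> Delta n k"
    show "(\<lambda>\<omega>. ALG n k \<alpha> A t \<omega> x) \<in> measurable (alg_space n k \<alpha> M t) (count_space (Pow {1..n}))"
      using assms(6) x
      by (intro measurable_ALG) (auto simp: submodular_dominance_def randomized_procedure_def Delta_def)
    fix f :: "nat set \<Rightarrow> real" assume f: "submodular_on {1..n} f"
    have "(LINT q|alg_space n k \<alpha> M t. indicator (ALG n k \<alpha> A t q x) i) = x i" if i: "i \<in> {1..n}" for i
    proof (rule antisym)
      let ?I = "\<lambda>q. indicator (ALG n k \<alpha> A t q x) i :: real"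
      have "c * x i \<le> (LINT q|alg_space n k \<alpha> M t. c * ?I q)" for c
        using dom[OF x submodular_on_member[of _ c i]] i by (simp add: multilinear_extension_member)
      from this[of 1] this[of "- 1"]
      show "x i \<le> (LINT q|alg_space n k \<alpha> M t. ?I q)" "(LINT q|alg_space n k \<alpha> M t. ?I q) \<le> x i"
        by simp_all
    qed
    then have "multilinear_extension {1..n} f (\<lambda>i. LINT q|alg_space n k \<alpha> M t. indicator (ALG n k \<alpha> A t q x) i)
        = multilinear_extension {1..n} f x"
      by (intro multilinear_extension_cong refl)
    then show "multilinear_extension {1..n} f (\<lambda>i. LINT q|alg_space n k \<alpha> M t. indicator (ALG n k \<alpha> A t q x) i)
        \<le> (LINT q|alg_space n k \<alpha> M t. f (ALG n k \<alpha> A t q x))"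
      using dom[OF x f] by simp
  qed
qed


end
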